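(* Let $G = H \wr \langle t \rangle$ be the restricted wreath product of a finitely generated group $H$ and an infinite cyclic group $\langle t \rangle \cong C_\infty$. Then the base group $N = \bigoplus_{i \in \mathbb{Z}} H^{t^i}$ has density $\delta_S(N) = 0$ in $G$, for every finite generating set $S$ of $G$.
   Context: The restricted (standard) wreath product $G = H \wr \langle t\rangle$ is the semidirect product $G = N \rtimes \langle t \rangle$, where the base group $N = \bigoplus_{i \in \mathbb{Z}} H^{t^i}$ is the direct sum of the conjugates $H^{t^i} = t^{-i} H t^i$ of $H$, $i \in \mathbb{Z}$. For a group $G$ with finite generating set $S$, $l_S(g)$ denotes the distance between $1$ and $g$ in the Cayley graph of $G$ with respect to $S$ (the word length of $g$ over $S \cup S^{-1}$), and $B_S(n) = \{ g \in G \mid l_S(g) \le n\}$ for $n \in \mathbb{N}_0$. The density of a subset $X \subseteq G$ with respect to $S$ is $$\delta_S(X) = \limsup_{n \to \infty} \frac{|X \cap B_S(n)|}{|B_S(n)|}.$$ *)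

theory Defs
  imports "HOL-Algebra.Algebra" "HOL-Library.Extended_Real"
begin

definition finitely_generated_group :: "('a, 'b) monoid_scheme \<Rightarrow> bool"
  where "finitely_generated_group G \<longleftrightarrow>
    group G \<and> (\<exists>A. finite A \<and> A \<subseteq> carrier G \<and> generate G A = carrier G)"

definition semidirect_product ::
    "('n, 'c) monoid_scheme \<Rightarrow> ('q, 'd) monoid_scheme \<Rightarrow> ('q \<Rightarrow> 'n \<Rightarrow> 'n) \<Rightarrow> ('n \<times> 'q) monoid"
  where "semidirect_product N Q \<alpha> =
    \<lparr>carrier = carrier N \<times> carrier Q,
     monoid.mult = (\<lambda>(x, p) (y, q). (x \<otimes>\<^bsub>N\<^esub> \<alpha> p y, p \<otimes>\<^bsub>Q\<^esub> q)),
     one = (\<one>\<^bsub>N\<^esub>, \<one>\<^bsub>Q\<^esub>)\<rparr>"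

text \<open>
  The pair \<open>(f, k)\<close> stands for \<open>f t\<^sup>k\<close>, where the coordinate \<open>f i\<close> of \<open>f\<close> is the component in the
  conjugate \<open>t\<^sup>-\<^sup>i H t\<^sup>i\<close>. Hence \<open>t\<^sup>k f t\<^sup>-\<^sup>k\<close> has \<open>i\<close>-th coordinate \<open>f (i + k)\<close>; see
  \<open>wreath_conj_coordinate\<close> below.
\<close>

definition wreath_int :: "('a, 'b) monoid_scheme \<Rightarrow> ((int \<Rightarrow> 'a) \<times> int) monoid"
  where "wreath_int H =
    semidirect_product (sum_group UNIV (\<lambda>_::int. H)) integer_group (\<lambda>k f i. f (i + k))"

definition wreath_base :: "('a, 'b) monoid_scheme \<Rightarrow> ((int \<Rightarrow> 'a) \<times> int) set"
  where "wreath_base H = carrier (sum_group UNIV (\<lambda>_::int. H)) \<times> {0}"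

definition word_length :: "('a, 'b) monoid_scheme \<Rightarrow> 'a set \<Rightarrow> 'a \<Rightarrow> nat"
  where "word_length G S g =
    (LEAST n. \<exists>ws. length ws = n \<and> set ws \<subseteq> S \<union> m_inv G ` S \<and>
                   foldr (\<otimes>\<^bsub>G\<^esub>) ws \<one>\<^bsub>G\<^esub> = g)"

definition word_ball :: "('a, 'b) monoid_scheme \<Rightarrow> 'a set \<Rightarrow> nat \<Rightarrow> 'a set"
  where "word_ball G S n = {g \<in> carrier G. word_length G S g \<le> n}"

definition growth_density :: "('a, 'b) monoid_scheme \<Rightarrow> 'a set \<Rightarrow> 'a set \<Rightarrow> ereal"
  where "growth_density G S A =
    limsup (\<lambda>n. ereal (real (card (A \<inter> word_ball G S n)) / real (card (word_ball G S n))))"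

lemma group_semidirect_product:
  assumes N: "group N" and Q: "group Q"
    and hom: "\<And>q. q \<in> carrier Q \<Longrightarrow> \<alpha> q \<in> hom N N"
    and mult: "\<And>p q x. p \<in> carrier Q \<Longrightarrow> q \<in> carrier Q \<Longrightarrow> x \<in> carrier N
               \<Longrightarrow> \<alpha> (p \<otimes>\<^bsub>Q\<^esub> q) x = \<alpha> p (\<alpha> q x)"
    and one: "\<And>x. x \<in> carrier N \<Longrightarrow> \<alpha> \<one>\<^bsub>Q\<^esub> x = x"
  shows "group (semidirect_product N Q \<alpha>)"
proof -
  interpret N: group N by (rule N)
  interpret Q: group Q by (rule Q)
  have cl: "\<alpha> q x \<in> carrier N" if "q \<in> carrier Q" "x \<in> carrier N" for q x
    using hom[OF that(1)] that(2) by (auto simp: hom_def)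
  have dist: "\<alpha> q (x \<otimes>\<^bsub>N\<^esub> y) = \<alpha> q x \<otimes>\<^bsub>N\<^esub> \<alpha> q y"
    if "q \<in> carrier Q" "x \<in> carrier N" "y \<in> carrier N" for q x y
    using hom[OF that(1)] that(2,3) by (auto simp: hom_def)
  have linv: "\<alpha> (inv\<^bsub>Q\<^esub> q) (inv\<^bsub>N\<^esub> (\<alpha> \<one>\<^bsub>Q\<^esub> x)) \<otimes>\<^bsub>N\<^esub> \<alpha> (inv\<^bsub>Q\<^esub> q) x = \<one>\<^bsub>N\<^esub>"
    if q: "q \<in> carrier Q" and x: "x \<in> carrier N" for q x
  proof -
    have "\<alpha> (inv\<^bsub>Q\<^esub> q) (inv\<^bsub>N\<^esub> x) \<otimes>\<^bsub>N\<^esub> \<alpha> (inv\<^bsub>Q\<^esub> q) x = \<alpha> (inv\<^bsub>Q\<^esub> q) \<one>\<^bsub>N\<^esub>"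
      using dist[of "inv\<^bsub>Q\<^esub> q" "inv\<^bsub>N\<^esub> x" x] q x by simp
    also have "\<dots> = \<one>\<^bsub>N\<^esub>"
      using hom_one[OF hom N N] q by simp
    finally show ?thesis using one x by simp
  qed
  show ?thesis
  proof (rule groupI)
    fix x assume x: "x \<in> carrier (semidirect_product N Q \<alpha>)"
    obtain a q where aq: "x = (a, q)" "a \<in> carrier N" "q \<in> carrier Q"
      using x by (auto simp: semidirect_product_def)
    show "\<exists>y\<in>carrier (semidirect_product N Q \<alpha>).
            y \<otimes>\<^bsub>semidirect_product N Q \<alpha>\<^esub> x = \<one>\<^bsub>semidirect_product N Q \<alpha>\<^esub>"
      by (rule bexI[where x = "(\<alpha> (inv\<^bsub>Q\<^esub> q) (inv\<^bsub>N\<^esub> (\<alpha> \<one>\<^bsub>Q\<^esub> a)), inv\<^bsub>Q\<^esub> q)"])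
         (use aq linv[of q a] cl in \<open>auto simp: semidirect_product_def\<close>)
  qed (auto simp: semidirect_product_def cl dist mult one N.m_assoc Q.m_assoc)
qed

lemma finite_support_shift:
  fixes f :: "int \<Rightarrow> 'a"
  assumes "finite {i. f i \<noteq> c}"
  shows "finite {i. f (i + k) \<noteq> c}"
proof -
  have "{i. f (i + k) \<noteq> c} = (\<lambda>i. i - k) ` {i. f i \<noteq> c}"
    by (auto simp: image_iff) (metis add_diff_cancel_right')
  with assms show ?thesis by simp
qed

lemma group_wreath_int:
  assumes "group H"
  shows "group (wreath_int H)"
  unfolding wreath_int_def
proof (rule group_semidirect_product)
  show "(\<lambda>f i. f (i + k)) \<in> hom (sum_group UNIV (\<lambda>_::int. H)) (sum_group UNIV (\<lambda>_::int. H))" for k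
    using assms by (auto simp: hom_def carrier_sum_group finite_support_shift)
qed (use assms in \<open>auto simp: algebra_simps\<close>)

lemma subgroup_wreath_base:
  assumes "group H"
  shows "subgroup (wreath_base H) (wreath_int H)"
proof -
  interpret W: group "wreath_int H" by (rule group_wreath_int[OF assms])
  let ?N = "sum_group UNIV (\<lambda>_::int. H)"
  have N: "group ?N" using assms by simp
  show ?thesis
  proof (rule W.subgroupI)
    show "wreath_base H \<subseteq> carrier (wreath_int H)"
      by (auto simp: wreath_base_def wreath_int_def semidirect_product_def)
    show "wreath_base H \<noteq> {}"
      using group.is_monoid[OF N, THEN monoid.one_closed] by (auto simp: wreath_base_def)
  next
    fix a assume a: "a \<in> wreath_base H"
    then obtain f where f: "a = (f, 0)" "f \<in> carrier ?N" by (auto simp: wreath_base_def)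
    have "inv\<^bsub>wreath_int H\<^esub> a = (inv\<^bsub>?N\<^esub> f, 0)"
      by (rule W.inv_equality)
         (use f group.l_inv[OF N f(2)] group.inv_closed[OF N f(2)] in
           \<open>auto simp: wreath_int_def semidirect_product_def simp del: inv_sum_group mult_sum_group one_sum_group\<close>)
    then show "inv\<^bsub>wreath_int H\<^esub> a \<in> wreath_base H"
      using f group.inv_closed[OF N f(2)] by (auto simp: wreath_base_def)
  next
    fix a b assume "a \<in> wreath_base H" "b \<in> wreath_base H"
    then show "a \<otimes>\<^bsub>wreath_int H\<^esub> b \<in> wreath_base H"
      using monoid.m_closed[OF group.is_monoid[OF N]]
      by (auto simp: wreath_base_def wreath_int_def semidirect_product_def simp del: mult_sum_group)
  qed
qed

lemma wreath_conj_coordinate: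
  fixes H :: "('a, 'b) monoid_scheme" and i :: int
  assumes H: "group H" and h: "h \<in> carrier H"
  defines "e \<equiv> \<lambda>j k::int. if k = j then h else \<one>\<^bsub>H\<^esub>"
  defines "t \<equiv> (\<lambda>_. \<one>\<^bsub>H\<^esub>, 1)"
  shows "t [^]\<^bsub>wreath_int H\<^esub> (- i) \<otimes>\<^bsub>wreath_int H\<^esub> (e 0, 0) \<otimes>\<^bsub>wreath_int H\<^esub> t [^]\<^bsub>wreath_int H\<^esub> i
         = (e i, 0)"
proof -
  let ?W = "wreath_int H"
  interpret H: group H by (rule H)
  interpret W: group ?W by (rule group_wreath_int[OF H])
  have carr: "(\<lambda>_. \<one>\<^bsub>H\<^esub>, k) \<in> carrier ?W" for k
    by (simp add: wreath_int_def semidirect_product_def carrier_sum_group H PiE_UNIV_domain)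
  have m: "(f, k) \<otimes>\<^bsub>?W\<^esub> (g, l) = (\<lambda>j. f j \<otimes>\<^bsub>H\<^esub> g (j + k), k + l)" for f g :: "int \<Rightarrow> 'a" and k l
    by (simp add: wreath_int_def semidirect_product_def restrict_UNIV)
  have o: "\<one>\<^bsub>?W\<^esub> = (\<lambda>_. \<one>\<^bsub>H\<^esub>, 0)"
    by (simp add: wreath_int_def semidirect_product_def restrict_UNIV)
  have n: "t [^]\<^bsub>?W\<^esub> (n::nat) = (\<lambda>_. \<one>\<^bsub>H\<^esub>, int n)" for n
    by (induction n) (simp_all add: o m t_def)
  have invn: "inv\<^bsub>?W\<^esub> (\<lambda>_. \<one>\<^bsub>H\<^esub>, k) = (\<lambda>_. \<one>\<^bsub>H\<^esub>, - k)" for k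
    by (rule W.inv_equality) (simp_all add: carr m o)
  have p: "t [^]\<^bsub>?W\<^esub> k = (\<lambda>_. \<one>\<^bsub>H\<^esub>, k)" for k :: int
    by (simp add: int_pow_def2 n invn)
  show ?thesis
    using h by (auto simp: p m e_def fun_eq_iff)
qed

end

theory Submission
  imports Defs
begin

text \<open>
  Let \<open>\<lambda>\<close> be the growth rate of \<open>G\<close>. Since \<open>\<lambda>\<^sup>n \<le> |B(n)|\<close> by submultiplicativity, it suffices that the
  sum of \<open>z ^ l(g)\<close> over the base group converges at \<open>z = 1/\<lambda>\<close>, hence that it is bounded uniformly for
  \<open>z < 1/\<lambda>\<close>.

  A word moves a cursor on the integers. A bridge of span \<open>T\<close> starts at the minimum of its cursor
  path and ends at the maximum, \<open>T\<close> higher. Bridges padded by a fixed power of \<open>t\<close> act on disjoint sites, so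
  a product of padded bridges determines its factors; as the growth series of \<open>G\<close> converges at \<open>z\<close>,
  the weight of the bridges of a given span is bounded independently of the span and of \<open>z\<close>.

  As in the Hammersley--Welsh unfolding of self-avoiding walks, a word that stays on one side of
  its start is a bridge to the last maximum followed by a word of smaller range on the other side of
  its start, and a closed word is a bridge with such a one-sided word at each end. At a
  junction of two factors, lamps at sites visited by both can be moved from one factor to the other
  without changing the product. The number of ways to do this grows exponentially with the smaller
  range, and this gain makes the sum over all decompositions converge.
\<close>

section \<open>Growth of finitely generated groups\<close>

locale generated_group = group G for G (structure) +
  fixes S :: "'a set"
  assumes finite_gens: "finite S"
    and gens_closed: "S \<subseteq> carrier G"
    and generated: "generate G S = carrier G"
begin

section \<open>Words over the symmetrised generators\<close>

definition words :: "'a list set"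
  where "words = lists (S \<union> m_inv G ` S)"

definition wval :: "'a list \<Rightarrow> 'a"
  where "wval ws = foldr (\<otimes>) ws \<one>"

definition winv :: "'a list \<Rightarrow> 'a list"
  where "winv ws = rev (map (m_inv G) ws)"

abbreviation len :: "'a \<Rightarrow> nat"
  where "len \<equiv> word_length G S"

abbreviation ball :: "nat \<Rightarrow> 'a set"
  where "ball \<equiv> word_ball G S"

lemma letters_closed: "S \<union> m_inv G ` S \<subseteq> carrier G"
  using gens_closed by auto

lemma finite_letters: "finite (S \<union> m_inv G ` S)"
  using finite_gens by simp

lemma words_append [simp]: "u @ v \<in> words \<longleftrightarrow> u \<in> words \<and> v \<in> words"
  by (auto simp: words_def)

lemma words_Nil [simp]: "[] \<in> words"
  by (simp add: words_def)

lemma words_take: "w \<in> words \<Longrightarrow> take n w \<in> words"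
  by (metis append_take_drop_id words_append)

lemma words_drop: "w \<in> words \<Longrightarrow> drop n w \<in> words"
  by (metis append_take_drop_id words_append)

lemma words_Cons: "s # w \<in> words \<longleftrightarrow> s \<in> S \<union> m_inv G ` S \<and> w \<in> words"
  by (simp add: words_def)

lemma wval_Nil [simp]: "wval [] = \<one>"
  by (simp add: wval_def)

lemma wval_Cons [simp]: "wval (s # w) = s \<otimes> wval w"
  by (simp add: wval_def)

lemma wval_closed [simp]: "w \<in> words \<Longrightarrow> wval w \<in> carrier G"
  by (induction w) (use letters_closed in \<open>simp, simp add: words_Cons subset_iff del: Un_iff\<close>)

lemma wval_append: "u \<in> words \<Longrightarrow> v \<in> words \<Longrightarrow> wval (u @ v) = wval u \<otimes> wval v"
  by (induction u) (use letters_closed in \<open>auto simp: words_Cons m_assoc subset_iff\<close>)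

lemma letters_inv: "s \<in> S \<union> m_inv G ` S \<Longrightarrow> inv s \<in> S \<union> m_inv G ` S"
  using gens_closed by auto

lemma winv_words [simp]: "w \<in> words \<Longrightarrow> winv w \<in> words"
  using letters_inv by (auto simp: words_def winv_def in_lists_conv_set)

lemma length_winv [simp]: "length (winv w) = length w"
  by (simp add: winv_def)

lemma winv_Cons: "winv (s # w) = winv w @ [inv s]"
  by (simp add: winv_def)

lemma winv_append: "winv (u @ v) = winv v @ winv u"
  by (simp add: winv_def)

lemma wval_winv: "w \<in> words \<Longrightarrow> wval (winv w) = inv (wval w)"
proof (induction w)
  case Nil
  then show ?case by (simp add: winv_def)
next
  case (Cons s w)
  then have w: "w \<in> words" and s: "s \<in> S \<union> m_inv G ` S" by (auto simp: words_Cons)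
  have sc: "s \<in> carrier G" using s letters_closed by blast
  have i: "[inv s] \<in> words" using letters_inv[OF s] by (simp add: words_Cons)
  have "wval (winv (s # w)) = wval (winv w) \<otimes> wval [inv s]"
    using w i by (simp only: winv_Cons wval_append winv_words)
  also have "\<dots> = inv (wval (s # w))"
    using Cons.IH w sc by (simp add: inv_mult_group)
  finally show ?case .
qed

lemma winv_winv: "w \<in> words \<Longrightarrow> winv (winv w) = w"
  by (induction w) (use letters_closed in \<open>auto simp: words_Cons winv_Cons winv_append, auto simp: winv_def\<close>)

lemma word_exists:
  assumes "g \<in> carrier G"
  shows "\<exists>w\<in>words. wval w = g"
proof -
  have "g \<in> generate G S" using assms generated by simp
  then show ?thesis
  proof (induction g rule: generate.induct)
    case one
    show ?case by (rule bexI[of _ "[]"]) auto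
  next
    case (incl h)
    then show ?case by (intro bexI[of _ "[h]"]) (use gens_closed in \<open>auto simp: words_Cons\<close>)
  next
    case (inv h)
    then show ?case by (intro bexI[of _ "[inv h]"]) (use gens_closed in \<open>auto simp: words_Cons\<close>)
  next
    case (eng h1 h2)
    then show ?case by (metis wval_append words_append)
  qed
qed

lemma word_length_eq:
  "len g = (LEAST n. \<exists>w. length w = n \<and> w \<in> words \<and> wval w = g)"
  unfolding word_length_def words_def wval_def lists_eq_set by simp

lemma geodesic_exists:
  assumes "g \<in> carrier G"
  obtains w where "w \<in> words" "wval w = g" "length w = len g"
proof -
  obtain w where "w \<in> words" "wval w = g" using word_exists[OF assms] by blast
  then have "\<exists>n w. length w = n \<and> w \<in> words \<and> wval w = g" by blast
  from LeastI_ex[OF this] show ?thesis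
    unfolding word_length_eq[symmetric] using that by blast
qed

lemma len_le_length: "w \<in> words \<Longrightarrow> len (wval w) \<le> length w"
  unfolding word_length_eq by (rule Least_le) auto

lemma len_mult_le:
  assumes "g \<in> carrier G" "h \<in> carrier G"
  shows "len (g \<otimes> h) \<le> len g + len h"
proof -
  obtain u where "u \<in> words" "wval u = g" "length u = len g" by (rule geodesic_exists[OF assms(1)])
  moreover obtain v where "v \<in> words" "wval v = h" "length v = len h" by (rule geodesic_exists[OF assms(2)])
  ultimately show ?thesis using len_le_length[of "u @ v"] by (auto simp: wval_append)
qed

section \<open>Sizes of balls and the growth series\<close>

lemma finite_ball: "finite (ball n)"
proof -
  have "ball n \<subseteq> wval ` {w. set w \<subseteq> S \<union> m_inv G ` S \<and> length w \<le> n}"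
  proof
    fix g assume "g \<in> ball n"
    then have g: "g \<in> carrier G" "len g \<le> n" by (auto simp: word_ball_def)
    obtain w where "w \<in> words" "wval w = g" "length w = len g" by (rule geodesic_exists[OF g(1)])
    moreover from this have "set w \<subseteq> S \<union> m_inv G ` S" by (simp add: words_def lists_eq_set)
    ultimately show "g \<in> wval ` {w. set w \<subseteq> S \<union> m_inv G ` S \<and> length w \<le> n}"
      using g by (intro image_eqI[of _ _ w]) simp_all
  qed
  then show ?thesis
    by (rule finite_subset) (intro finite_imageI finite_lists_length_le[OF finite_letters])
qed

text \<open>A geodesic word cut after \<open>m\<close> letters gives a factor in each of the two
  smaller balls.\<close>

lemma card_ball_add: "card (ball (m + n)) \<le> card (ball m) * card (ball n)"
proof -
  have "ball (m + n) \<subseteq> (\<lambda>(g, h). g \<otimes> h) ` (ball m \<times> ball n)"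
  proof
    fix g assume "g \<in> ball (m + n)"
    then have g: "g \<in> carrier G" "len g \<le> m + n" by (auto simp: word_ball_def)
    obtain w where w: "w \<in> words" "wval w = g" "length w = len g" by (rule geodesic_exists[OF g(1)])
    have tw: "take m w \<in> words" "drop m w \<in> words"
      using w(1) by (simp_all add: words_take words_drop)
    have "wval (take m w) \<in> ball m" "wval (drop m w) \<in> ball n"
      using len_le_length[OF tw(1)] len_le_length[OF tw(2)] tw w(3) g by (simp_all add: word_ball_def)
    moreover have "g = wval (take m w) \<otimes> wval (drop m w)"
      using wval_append[OF tw] w(2) by (metis append_take_drop_id)
    ultimately show "g \<in> (\<lambda>(g, h). g \<otimes> h) ` (ball m \<times> ball n)"
      by (intro image_eqI[of _ _ "(wval (take m w), wval (drop m w))"]) simp_all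
  qed
  then have "card (ball (m + n)) \<le> card (ball m \<times> ball n)"
    by (intro surj_card_le[OF finite_cartesian_product[OF finite_ball finite_ball]])
  then show ?thesis by (simp add: card_cartesian_product)
qed

lemma len_one [simp]: "len \<one> = 0"
  using len_le_length[of "[]"] by simp

lemma card_ball_pos: "card (ball n) > 0"
proof -
  have "\<one> \<in> ball n" by (simp add: word_ball_def)
  then show ?thesis using finite_ball card_gt_0_iff by blast
qed

lemma card_ball_mult_le: "card (ball (q * m)) \<le> card (ball m) ^ q * card (ball 0)"
proof (induction q)
  case (Suc q)
  have "card (ball (Suc q * m)) \<le> card (ball m) * card (ball (q * m))"
    using card_ball_add[of m "q * m"] by simp
  also have "\<dots> \<le> card (ball m) * (card (ball m) ^ q * card (ball 0))"
    using Suc by (intro mult_le_mono) auto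
  finally show ?case by simp
qed simp

text \<open>Elements with \<open>len g div m = q\<close> lie in a ball of at most
  \<open>card (ball m) ^ Suc q * card (ball 0)\<close> elements and weigh at most
  \<open>z ^ (q * m)\<close> each, so the shells are dominated by a geometric series of ratio
  \<open>card (ball m) * z ^ m\<close>.\<close>

lemma growth_series_bounded:
  fixes z :: real
  assumes m: "m > 0" and z: "0 < z" "z \<le> 1" and small: "real (card (ball m)) * z ^ m < 1"
  shows "\<exists>b. \<forall>F. finite F \<longrightarrow> F \<subseteq> carrier G \<longrightarrow> (\<Sum>g\<in>F. z ^ len g) \<le> b"
proof -
  define b where "b = real (card (ball m))"
  define \<rho> where "\<rho> = b * z ^ m"
  define c where "c = b * real (card (ball 0))"
  have b0: "b \<ge> 0" "c \<ge> 0" by (auto simp: b_def c_def)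
  have \<rho>: "0 \<le> \<rho>" "\<rho> < 1" using small b0 z by (auto simp: \<rho>_def b_def)
  have "(\<Sum>g\<in>F. z ^ len g) \<le> c / (1 - \<rho>)" if F: "finite F" "F \<subseteq> carrier G" for F
  proof -
    define Q where "Q = (\<lambda>g. len g div m) ` F"
    have Q: "finite Q" using F by (simp add: Q_def)
    have "(\<Sum>g\<in>F. z ^ len g) = (\<Sum>q\<in>Q. \<Sum>g\<in>{g\<in>F. len g div m = q}. z ^ len g)"
      using F Q by (intro sum.group[symmetric]) (auto simp: Q_def)
    also have "\<dots> \<le> (\<Sum>q\<in>Q. c * \<rho> ^ q)"
    proof (rule sum_mono)
      fix q
      let ?Y = "{g\<in>F. len g div m = q}"
      have sub: "?Y \<subseteq> ball (Suc q * m)"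
      proof
        fix g assume g: "g \<in> ?Y"
        have "len g < Suc (len g div m) * m" using m by (metis add.commute dividend_less_div_times mult_Suc)
        then show "g \<in> ball (Suc q * m)" using g F by (auto simp: word_ball_def)
      qed
      have le: "z ^ len g \<le> z ^ (q * m)" if "g \<in> ?Y" for g
      proof -
        have "q * m \<le> len g" using that by auto
        then show ?thesis using z by (intro power_decreasing) auto
      qed
      have "(\<Sum>g\<in>?Y. z ^ len g) \<le> real (card ?Y) * z ^ (q * m)"
        using sum_bounded_above[of ?Y "\<lambda>g. z ^ len g" "z ^ (q * m)"] le by simp
      also have "\<dots> \<le> (b ^ Suc q * real (card (ball 0))) * z ^ (q * m)"
      proof (rule mult_right_mono)
        have "card ?Y \<le> card (ball (Suc q * m))" by (rule card_mono[OF finite_ball sub])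
        also have "\<dots> \<le> card (ball m) ^ Suc q * card (ball 0)" by (rule card_ball_mult_le)
        finally have "real (card ?Y) \<le> real (card (ball m) ^ Suc q * card (ball 0))" by (simp only: of_nat_le_iff)
        then show "real (card ?Y) \<le> b ^ Suc q * real (card (ball 0))" by (simp add: b_def)
      qed (use z in auto)
      also have "\<dots> = c * \<rho> ^ q"
        by (simp add: c_def \<rho>_def power_mult_distrib power_mult[symmetric] mult.commute[of q m] algebra_simps)
      finally show "(\<Sum>g\<in>?Y. z ^ len g) \<le> c * \<rho> ^ q" .
    qed
    also have "\<dots> = c * (\<Sum>q\<in>Q. \<rho> ^ q)" by (simp add: sum_distrib_left)
    also have "\<dots> \<le> c * (1 / (1 - \<rho>))"
    proof (rule mult_left_mono)
      have "(\<Sum>q\<in>Q. \<rho> ^ q) \<le> suminf (\<lambda>q. \<rho> ^ q)"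
        using \<rho> Q by (intro sum_le_suminf summable_geometric) auto
      then show "(\<Sum>q\<in>Q. \<rho> ^ q) \<le> 1 / (1 - \<rho>)" using \<rho> by (simp add: suminf_geometric)
    qed (use b0 in simp)
    finally show ?thesis by simp
  qed
  then show ?thesis by blast
qed

text \<open>By submultiplicativity of the ball sizes (Fekete) this infimum is also the limit of the
  \<open>n\<close>-th roots. The infimum form gives at once a lower bound for every ball and, below
  the radius \<open>1 / growth_rate\<close>, one ball with
  \<open>card (ball m) * z ^ m < 1\<close>.\<close>

definition growth_rate :: real
  where "growth_rate = (INF n\<in>{1..}. root n (real (card (ball n))))"

lemma growth_rate_bdd: "bdd_below ((\<lambda>n. root n (real (card (ball n)))) ` {1..})"
  by (rule bdd_belowI[of _ 0]) auto

lemma growth_rate_ge_1: "growth_rate \<ge> 1"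
  unfolding growth_rate_def
proof (rule cINF_greatest)
  fix n :: nat assume "n \<in> {1..}"
  moreover have "real (card (ball n)) \<ge> 1" using card_ball_pos[of n] by linarith
  ultimately show "1 \<le> root n (real (card (ball n)))" by simp
qed auto

lemma growth_rate_power_le: "growth_rate ^ n \<le> real (card (ball n))"
proof (cases "n = 0")
  case True
  then show ?thesis using card_ball_pos[of n] by (simp add: Suc_leI)
next
  case False
  have "growth_rate \<le> root n (real (card (ball n)))"
    unfolding growth_rate_def using False by (intro cINF_lower growth_rate_bdd) auto
  then have "growth_rate ^ n \<le> root n (real (card (ball n))) ^ n"
    using growth_rate_ge_1 by (intro power_mono) auto
  then show ?thesis using False by simp
qed

lemma growth_series_bounded_below_radius:
  fixes z :: real
  assumes z: "0 < z" "z < 1 / growth_rate"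
  shows "\<exists>b. \<forall>F. finite F \<longrightarrow> F \<subseteq> carrier G \<longrightarrow> (\<Sum>g\<in>F. z ^ len g) \<le> b"
proof -
  have "growth_rate < 1 / z" using z growth_rate_ge_1 by (simp add: field_simps)
  then obtain m where m: "m \<in> {1..}" "root m (real (card (ball m))) < 1 / z"
    unfolding growth_rate_def using growth_rate_bdd by (subst (asm) cINF_less_iff) auto
  have "real (card (ball m)) = root m (real (card (ball m))) ^ m" using m by simp
  also have "\<dots> < (1 / z) ^ m" using m by (intro power_strict_mono) auto
  finally have "real (card (ball m)) * z ^ m < 1" using z by (simp add: field_simps)
  moreover have "z \<le> 1"
    using z growth_rate_ge_1 by (smt (verit) divide_le_eq_1)
  ultimately show ?thesis using growth_series_bounded[of m z] m z by auto
qed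

text \<open>A Markov-type estimate: an element of length at most \<open>n\<close> weighs at least
  \<open>1 / growth_rate ^ n\<close>, so outside a fixed ball the elements of \<open>N\<close> in
  \<open>ball n\<close> number at most \<open>card (ball n)\<close> times the tail of the series.
  The fixed ball is negligible because ball sizes tend to infinity.\<close>

lemma growth_density_zero:
  assumes NG: "N \<subseteq> carrier G" and inf: "infinite (carrier G)"
    and bound: "\<And>F. finite F \<Longrightarrow> F \<subseteq> N \<Longrightarrow> (\<Sum>g\<in>F. (1 / growth_rate) ^ len g) \<le> M"
  shows "growth_density G S N = 0"
proof -
  define r where "r = 1 / growth_rate"
  have r: "0 < r" using growth_rate_ge_1 by (simp add: r_def)
  define a where "a n = real (card (N \<inter> ball n)) / real (card (ball n))" for n
  define s where "s n = (\<Sum>g\<in>N \<inter> ball n. r ^ len g)" for n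
  have fin: "finite (N \<inter> ball n)" for n using finite_ball by simp
  have mono: "ball m \<subseteq> ball n" if "m \<le> n" for m n using that by (auto simp: word_ball_def)
  have smono: "incseq s"
    unfolding s_def by (intro incseq_SucI sum_mono2 fin) (use r mono[OF le_SucI[OF order_refl]] in auto)
  have sle: "\<forall>n. s n \<le> M" unfolding s_def r_def by (intro allI bound[OF fin]) auto
  obtain L where L: "s \<longlonglongrightarrow> L" "\<And>n. s n \<le> L"
    using incseq_convergent[OF smono sle] by blast
  have unb: "\<exists>n0. \<forall>n\<ge>n0. real (card (ball n)) \<ge> real K" for K :: nat
  proof -
    obtain E where E: "E \<subseteq> carrier G" "finite E" "card E = K"
      using infinite_arbitrarily_large[OF inf] by metis
    define n0 where "n0 = Max (insert 0 (len ` E))"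
    have "E \<subseteq> ball n0" using E by (auto simp: word_ball_def n0_def)
    then have "E \<subseteq> ball n" if "n \<ge> n0" for n using mono[OF that] by blast
    then have "K \<le> card (ball n)" if "n \<ge> n0" for n
      using E card_mono[OF finite_ball, of E n] that by blast
    then show ?thesis by auto
  qed
  have "a \<longlonglongrightarrow> 0"
  proof (rule LIMSEQ_I)
    fix e :: real assume e: "e > 0"
    \<comment> \<open>Beyond the ball of radius \<open>n0\<close> the series has a tail below
      \<open>e / 2\<close>; \<open>K\<close> is chosen so that this ball is less than the share
      \<open>e / 2\<close> of any ball with at least \<open>K\<close> elements.\<close>
    obtain n0 where n0: "s n0 > L - e / 2"
      using order_tendstoD(1)[OF L(1), of "L - e / 2"] e eventually_sequentially by auto
    obtain K :: nat where K: "real (card (ball n0)) / (e / 2) < real K" using reals_Archimedean2 by blast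
    obtain n1 where n1: "\<forall>n\<ge>n1. real (card (ball n)) \<ge> real K" using unb by blast
    have "norm (a n - 0) < e" if n: "n \<ge> max n0 n1" for n
    proof -
      let ?D = "N \<inter> ball n - N \<inter> ball n0"
      have split: "N \<inter> ball n = ?D \<union> (N \<inter> ball n0)" using mono[of n0 n] n by auto
      have "(\<Sum>g\<in>N \<inter> ball n. r ^ len g) = (\<Sum>g\<in>?D. r ^ len g) + (\<Sum>g\<in>N \<inter> ball n0. r ^ len g)"
        using mono[of n0 n] n by (intro sum.subset_diff fin) auto
      then have sD: "(\<Sum>g\<in>?D. r ^ len g) < e / 2"
        using L(2)[of n] n0 by (simp add: s_def)
      have gn: "growth_rate ^ n * r ^ len g \<ge> 1" if "g \<in> ?D" for g
      proof -
        have "len g \<le> n" using that by (auto simp: word_ball_def)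
        then have "growth_rate ^ len g \<le> growth_rate ^ n"
          using growth_rate_ge_1 by (intro power_increasing) auto
        then have "growth_rate ^ len g * r ^ len g \<le> growth_rate ^ n * r ^ len g"
          using r by (intro mult_right_mono) auto
        moreover have "growth_rate ^ len g * r ^ len g = 1"
          using growth_rate_ge_1 by (simp add: r_def power_mult_distrib[symmetric])
        ultimately show ?thesis by linarith
      qed
      have "real (card ?D) = (\<Sum>g\<in>?D. 1)" by simp
      also have "\<dots> \<le> (\<Sum>g\<in>?D. growth_rate ^ n * r ^ len g)" by (rule sum_mono) (rule gn)
      also have "\<dots> = growth_rate ^ n * (\<Sum>g\<in>?D. r ^ len g)" by (simp add: sum_distrib_left)
      also have "\<dots> \<le> growth_rate ^ n * (e / 2)"
        using sD growth_rate_ge_1 by (intro mult_left_mono) auto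
      also have "\<dots> \<le> real (card (ball n)) * (e / 2)"
        using growth_rate_power_le e by (intro mult_right_mono) auto
      finally have D: "real (card ?D) \<le> real (card (ball n)) * (e / 2)" .
      have "card (N \<inter> ball n) \<le> card ?D + card (N \<inter> ball n0)"
        using card_Un_le[of ?D "N \<inter> ball n0"] split by argo
      moreover have "card (N \<inter> ball n0) \<le> card (ball n0)" by (rule card_mono[OF finite_ball]) auto
      ultimately have "real (card (N \<inter> ball n)) \<le> real (card ?D) + real (card (ball n0))" by linarith
      moreover have "real (card (ball n0)) < real (card (ball n)) * (e / 2)"
      proof -
        have "real (card (ball n0)) < real K * (e / 2)" using K e by (simp add: field_simps)
        also have "\<dots> \<le> real (card (ball n)) * (e / 2)" using n1 n e by (intro mult_right_mono) auto
        finally show ?thesis .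
      qed
      ultimately have "real (card (N \<inter> ball n)) < real (card (ball n)) * e" using D by argo
      then show ?thesis using card_ball_pos[of n] by (simp add: a_def field_simps)
    qed
    then show "\<exists>no. \<forall>n\<ge>no. norm (a n - 0) < e" by blast
  qed
  then have "(\<lambda>n. ereal (a n)) \<longlonglongrightarrow> 0" by (simp add: zero_ereal_def)
  then have "limsup (\<lambda>n. ereal (a n)) = 0" by (intro lim_imp_Limsup) auto
  then show ?thesis by (simp add: growth_density_def a_def)
qed

text \<open>Estimates are available only for \<open>z\<close> strictly below the radius. A finite
  sum is continuous in \<open>z\<close>, so a uniform bound passes to the left limit.\<close>

lemma sum_at_radius_le:
  assumes F: "finite F" and z0: "z0 < 1 / growth_rate"
    and le: "\<And>z. z0 \<le> z \<Longrightarrow> z < 1 / growth_rate \<Longrightarrow> (\<Sum>g\<in>F. z ^ len g) \<le> M"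
  shows "(\<Sum>g\<in>F. (1 / growth_rate) ^ len g) \<le> M"
proof (rule tendsto_upperbound)
  show "((\<lambda>z. \<Sum>g\<in>F. z ^ len g) \<longlongrightarrow> (\<Sum>g\<in>F. (1 / growth_rate) ^ len g)) (at_left (1 / growth_rate))"
    by (intro tendsto_sum tendsto_power tendsto_ident_at)
  show "\<forall>\<^sub>F z in at_left (1 / growth_rate). (\<Sum>g\<in>F. z ^ len g) \<le> M"
    using eventually_at_left_field z0 le by (smt (verit, ccfv_SIG))
qed auto

end

section \<open>Weights of sets of words\<close>

context generated_group
begin

text \<open>
  Injectivity of the value map on \<open>V\<close> makes this a bound on the sum over the group elements with a word
  in \<open>U\<close>, each weighted by its shortest word in \<open>U\<close>.
\<close>

definition wbound :: "real \<Rightarrow> 'a list set \<Rightarrow> real \<Rightarrow> bool"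
  where "wbound z U M \<longleftrightarrow>
    (\<forall>V. finite V \<longrightarrow> V \<subseteq> U \<longrightarrow> inj_on wval V \<longrightarrow> (\<Sum>w\<in>V. z ^ length w) \<le> M)"

lemma wboundI:
  "(\<And>V. finite V \<Longrightarrow> V \<subseteq> U \<Longrightarrow> inj_on wval V \<Longrightarrow> (\<Sum>w\<in>V. z ^ length w) \<le> M) \<Longrightarrow> wbound z U M"
  by (simp add: wbound_def)

lemma wboundD:
  "wbound z U M \<Longrightarrow> finite V \<Longrightarrow> V \<subseteq> U \<Longrightarrow> inj_on wval V \<Longrightarrow> (\<Sum>w\<in>V. z ^ length w) \<le> M"
  by (simp add: wbound_def)

lemma wbound_nonneg: "wbound z U M \<Longrightarrow> 0 \<le> M"
  using wboundD[of z U M "{}"] by simp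

lemma wbound_mono: "wbound z U M \<Longrightarrow> M \<le> M' \<Longrightarrow> wbound z U M'"
  unfolding wbound_def by (meson order_trans)

text \<open>Each word is charged to one chosen piece, and injectivity of \<open>wval\<close> passes
  to subsets. Totals run over finite index sets because \<open>J\<close> may be infinite, whereas a
  finite \<open>V\<close> meets only finitely many chosen pieces.\<close>

lemma wbound_cover:
  assumes z: "0 \<le> z"
    and cover: "\<And>w. w \<in> U \<Longrightarrow> \<exists>j\<in>J. w \<in> U' j"
    and bound: "\<And>j. j \<in> J \<Longrightarrow> wbound z (U' j) (M j)"
    and total: "\<And>J'. finite J' \<Longrightarrow> J' \<subseteq> J \<Longrightarrow> sum M J' \<le> B"
  shows "wbound z U B"
proof (rule wboundI)
  fix V assume V: "finite V" "V \<subseteq> U" "inj_on wval V"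
  obtain idx where idx: "\<And>w. w \<in> U \<Longrightarrow> idx w \<in> J \<and> w \<in> U' (idx w)"
    using cover by metis
  define J' where "J' = idx ` V"
  have J': "finite J'" "J' \<subseteq> J" using V idx by (auto simp: J'_def)
  have "(\<Sum>w\<in>V. z ^ length w) = (\<Sum>j\<in>J'. \<Sum>w\<in>{w\<in>V. idx w = j}. z ^ length w)"
    using V J' by (intro sum.group[symmetric]) (auto simp: J'_def)
  also have "\<dots> \<le> sum M J'"
  proof (rule sum_mono)
    fix j assume j: "j \<in> J'"
    have "{w\<in>V. idx w = j} \<subseteq> U' j" using V(2) idx by blast
    moreover have "inj_on wval {w\<in>V. idx w = j}" by (rule inj_on_subset[OF V(3)]) auto
    ultimately show "(\<Sum>w\<in>{w\<in>V. idx w = j}. z ^ length w) \<le> M j"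
      using V(1) j J' by (intro wboundD[OF bound]) auto
  qed
  also have "\<dots> \<le> B" by (rule total[OF J'])
  finally show "(\<Sum>w\<in>V. z ^ length w) \<le> B" .
qed

text \<open>Makes a finite family injective under \<open>wval\<close>, so that \<open>wbound\<close>
  applies to it; for \<open>z\<close> between 0 and 1, passing to a shorter word never lowers the
  weight.\<close>

lemma shortest_representatives:
  assumes "finite V"
  obtains R where "finite R" "R \<subseteq> V" "inj_on wval R"
    "\<forall>w\<in>V. \<exists>r\<in>R. wval r = wval w \<and> length r \<le> length w"
proof -
  define r where "r g = (ARG_MIN length w. w \<in> V \<and> wval w = g)" for g
  have r: "r (wval w) \<in> V \<and> wval (r (wval w)) = wval w" "length (r (wval w)) \<le> length w" if "w \<in> V" for w
    using arg_min_natI[of "\<lambda>u. u \<in> V \<and> wval u = wval w" w length]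
      arg_min_nat_le[of "\<lambda>u. u \<in> V \<and> wval u = wval w" w length] that by (auto simp: r_def)
  show ?thesis
  proof (rule that[of "r ` wval ` V"])
    show "inj_on wval (r ` wval ` V)" using r by (auto simp: inj_on_def)
  qed (use assms r in auto)
qed

text \<open>Every pair \<open>(w, i)\<close> can be read off from three values, so the double sum is
  dominated by a triple sum that factors. The index \<open>i\<close> stands for a way of altering a
  decomposition of \<open>w\<close>, and \<open>c i\<close> for the letters this costs; many
  alterations of the same word turn into a gain.\<close>

lemma wbound_transfer:
  fixes V :: "'a list set" and c :: "'i \<Rightarrow> nat"
  assumes z: "0 < z" "z \<le> 1"
    and V: "finite V" and I: "finite I"
    and bounds: "wbound z U1 M1" "wbound z U2 M2" "wbound z U3 M3"
    and mem: "\<And>w i. w \<in> V \<Longrightarrow> i \<in> I \<Longrightarrow> p1 w i \<in> U1 \<and> p2 w i \<in> U2 \<and> p3 w i \<in> U3 \<and>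
        length (p1 w i) + length (p2 w i) + length (p3 w i) \<le> length w + c i"
    and inj: "inj_on (\<lambda>(w, i). (wval (p1 w i), wval (p2 w i), wval (p3 w i))) (V \<times> I)"
  shows "(\<Sum>w\<in>V. z ^ length w) * (\<Sum>i\<in>I. z ^ c i) \<le> M1 * M2 * M3"
proof -
  have fin: "finite ((\<lambda>(w, i). p w i) ` (V \<times> I))" for p :: "'a list \<Rightarrow> 'i \<Rightarrow> 'a list"
    using V I by simp
  obtain R1 where R1: "finite R1" "R1 \<subseteq> (\<lambda>(w, i). p1 w i) ` (V \<times> I)" "inj_on wval R1"
      "\<forall>w\<in>(\<lambda>(w, i). p1 w i) ` (V \<times> I). \<exists>r\<in>R1. wval r = wval w \<and> length r \<le> length w"
    by (rule shortest_representatives[OF fin[of p1]])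
  obtain R2 where R2: "finite R2" "R2 \<subseteq> (\<lambda>(w, i). p2 w i) ` (V \<times> I)" "inj_on wval R2"
      "\<forall>w\<in>(\<lambda>(w, i). p2 w i) ` (V \<times> I). \<exists>r\<in>R2. wval r = wval w \<and> length r \<le> length w"
    by (rule shortest_representatives[OF fin[of p2]])
  obtain R3 where R3: "finite R3" "R3 \<subseteq> (\<lambda>(w, i). p3 w i) ` (V \<times> I)" "inj_on wval R3"
      "\<forall>w\<in>(\<lambda>(w, i). p3 w i) ` (V \<times> I). \<exists>r\<in>R3. wval r = wval w \<and> length r \<le> length w"
    by (rule shortest_representatives[OF fin[of p3]])
  have sub: "R1 \<subseteq> U1" "R2 \<subseteq> U2" "R3 \<subseteq> U3"
    using mem by (auto intro!: subset_trans[OF R1(2)] subset_trans[OF R2(2)] subset_trans[OF R3(2)])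
  define val where "val = (\<lambda>(w, i). (wval (p1 w i), wval (p2 w i), wval (p3 w i)))"
  \<comment> \<open>Outside the image of \<open>val\<close> the result is unspecified. This is
    harmless, since \<open>sum_le_included\<close> asks only for one preimage of each pair.\<close>
  define decode where "decode = (\<lambda>(u1, u2, u3). the_inv_into (V \<times> I) val (wval u1, wval u2, wval u3))"
  have "(\<Sum>w\<in>V. z ^ length w) * (\<Sum>i\<in>I. z ^ c i) = (\<Sum>(w, i)\<in>V \<times> I. z ^ length w * z ^ c i)"
    by (simp add: sum_product sum.cartesian_product)
  also have "\<dots> \<le> (\<Sum>(u1, u2, u3)\<in>R1 \<times> R2 \<times> R3. z ^ length u1 * (z ^ length u2 * z ^ length u3))"
  proof (rule sum_le_included[where i = decode])
    show "\<forall>x\<in>V \<times> I. \<exists>y\<in>R1 \<times> R2 \<times> R3. decode y = x \<and>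
       (case x of (w, i) \<Rightarrow> z ^ length w * z ^ c i)
         \<le> (case y of (u1, u2, u3) \<Rightarrow> z ^ length u1 * (z ^ length u2 * z ^ length u3))"
    proof
      fix x assume x: "x \<in> V \<times> I"
      then obtain w i where wi: "x = (w, i)" "w \<in> V" "i \<in> I" by auto
      obtain u1 where u1: "u1 \<in> R1" "wval u1 = wval (p1 w i)" "length u1 \<le> length (p1 w i)"
        using R1(4) wi by force
      obtain u2 where u2: "u2 \<in> R2" "wval u2 = wval (p2 w i)" "length u2 \<le> length (p2 w i)"
        using R2(4) wi by force
      obtain u3 where u3: "u3 \<in> R3" "wval u3 = wval (p3 w i)" "length u3 \<le> length (p3 w i)"
        using R3(4) wi by force
      have "decode (u1, u2, u3) = the_inv_into (V \<times> I) val (val x)"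
        by (simp add: decode_def val_def wi u1 u2 u3)
      also have "\<dots> = x" using inj x by (intro the_inv_into_f_f) (simp_all add: val_def)
      finally have "decode (u1, u2, u3) = x" .
      moreover have "z ^ length w * z ^ c i \<le> z ^ length u1 * (z ^ length u2 * z ^ length u3)"
      proof -
        have "length u1 + (length u2 + length u3) \<le> length w + c i"
          using mem[OF wi(2,3)] u1 u2 u3 by linarith
        then have "z ^ (length w + c i) \<le> z ^ (length u1 + (length u2 + length u3))"
          using z by (intro power_decreasing) auto
        then show ?thesis by (simp add: power_add)
      qed
      ultimately show "\<exists>y\<in>R1 \<times> R2 \<times> R3. decode y = x \<and>
       (case x of (w, i) \<Rightarrow> z ^ length w * z ^ c i)
         \<le> (case y of (u1, u2, u3) \<Rightarrow> z ^ length u1 * (z ^ length u2 * z ^ length u3))"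
        using u1 u2 u3 wi by (intro bexI[of _ "(u1, u2, u3)"]) auto
    qed
  qed (use V I R1 R2 R3 z in auto)
  also have "\<dots> = (\<Sum>u\<in>R1. z ^ length u) * ((\<Sum>u\<in>R2. z ^ length u) * (\<Sum>u\<in>R3. z ^ length u))"
    by (simp only: sum_product sum.cartesian_product) (auto intro!: sum.cong)
  also have "\<dots> \<le> M1 * (M2 * M3)"
    using z R1 R2 R3 sub bounds
    by (intro mult_mono wboundD[OF bounds(1)] wboundD[OF bounds(2)] wboundD[OF bounds(3)] mult_nonneg_nonneg sum_nonneg
        wbound_nonneg[OF bounds(1)] wbound_nonneg[OF bounds(2)] wbound_nonneg[OF bounds(3)]) auto
  finally show ?thesis by (simp add: mult.assoc)
qed

end

section \<open>Cursor paths\<close>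

definition shift :: "('b \<times> int) list \<Rightarrow> int"
  where "shift w = sum_list (map snd w)"

text \<open>The cursor positions after nonempty prefixes. The start is left out so that one-sided
  words can demand strict inequalities; it is added by \<open>insert 0\<close> where it
  counts.\<close>

primrec trail :: "('b \<times> int) list \<Rightarrow> int set"
  where "trail [] = {}"
  | "trail (s # w) = insert (snd s) ((+) (snd s) ` trail w)"

lemma shift_simps [simp]:
  "shift [] = 0" "shift (s # w) = snd s + shift w" "shift (u @ v) = shift u + shift v"
  by (simp_all add: shift_def)

lemma trail_append: "trail (u @ v) = trail u \<union> (+) (shift u) ` trail v"
  by (induction u) (auto simp: image_image image_Un add.assoc)

lemma trail_iff: "p \<in> trail w \<longleftrightarrow> (\<exists>u v. w = u @ v \<and> u \<noteq> [] \<and> p = shift u)"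
proof (induction w arbitrary: p)
  case (Cons s w)
  show ?case
  proof
    assume "p \<in> trail (s # w)"
    then consider "p = snd s" | q where "q \<in> trail w" "p = snd s + q" by auto
    then show "\<exists>u v. s # w = u @ v \<and> u \<noteq> [] \<and> p = shift u"
    proof cases
      case 1
      then show ?thesis by (intro exI[of _ "[s]"] exI[of _ w]) simp
    next
      case 2
      then obtain u v where "w = u @ v" "q = shift u" using Cons.IH by blast
      with 2 show ?thesis by (intro exI[of _ "s # u"] exI[of _ v]) simp
    qed
  next
    assume "\<exists>u v. s # w = u @ v \<and> u \<noteq> [] \<and> p = shift u"
    then obtain u v where u: "w = u @ v" "p = snd s + shift u" by (auto simp: Cons_eq_append_conv)
    show "p \<in> trail (s # w)"
    proof (cases "u = []")
      case False
      then have "shift u \<in> trail w" using Cons.IH u by blast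
      then show ?thesis using u by simp
    qed (use u in simp)
  qed
qed simp

lemma shift_prefix_in_trail: "shift u \<in> insert 0 (trail (u @ v))"
  using trail_iff[of "shift u" "u @ v"] by (cases "u = []") auto

lemma shift_in_trail: "shift w \<in> insert 0 (trail w)"
  using shift_prefix_in_trail[of w "[]"] by simp

lemma finite_trail: "finite (trail w)"
  by (induction w) auto

text \<open>The induction varies \<open>Q\<close>, since removing the first letter translates the
  condition. The letter \<open>s\<close> that enters \<open>Q\<close> is isolated so that the length
  of this last step can be estimated.\<close>

lemma first_passage:
  assumes "p \<in> trail w" "Q p"
  shows "\<exists>u s v. w = u @ s # v \<and> Q (shift (u @ [s])) \<and> (\<forall>p\<in>trail u. \<not> Q p)"
  using assms
proof (induction w arbitrary: p Q)
  case (Cons s w)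
  show ?case
  proof (cases "Q (snd s)")
    case True
    then show ?thesis by (intro exI[of _ "[]"] exI[of _ s] exI[of _ w]) simp
  next
    case False
    then obtain q where "q \<in> trail w" "Q (snd s + q)" using Cons.prems by auto
    from Cons.IH[of q "\<lambda>p. Q (snd s + p)", OF this]
    obtain u s' v where "w = u @ s' # v" "Q (snd s + shift (u @ [s']))" "\<forall>p\<in>trail u. \<not> Q (snd s + p)"
      by blast
    with False show ?thesis by (intro exI[of _ "s # u"] exI[of _ s'] exI[of _ v]) (auto simp: add.assoc)
  qed
qed simp

text \<open>The start is an admissible cut as well. If \<open>Q\<close> holds at some position from
  the first letter on, the cut lies there or later; otherwise the start itself is the cut.\<close>

lemma last_passage:
  assumes "p \<in> insert 0 (trail w)" "Q p"
  shows "\<exists>u v. w = u @ v \<and> Q (shift u) \<and> (\<forall>p\<in>trail v. \<not> Q (shift u + p))"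
  using assms
proof (induction w arbitrary: p Q)
  case Nil
  then show ?case by simp
next
  case (Cons s w)
  show ?case
  proof (cases "\<exists>q\<in>insert 0 (trail w). Q (snd s + q)")
    case True
    then obtain q where q: "q \<in> insert 0 (trail w)" "Q (snd s + q)" by blast
    from Cons.IH[of q "\<lambda>p. Q (snd s + p)", OF this]
    obtain u v where "w = u @ v" "Q (snd s + shift u)" "\<forall>p\<in>trail v. \<not> Q (snd s + (shift u + p))" by blast
    then show ?thesis by (intro exI[of _ "s # u"] exI[of _ v]) (simp add: add.assoc)
  next
    case False
    then have no: "\<not> Q q" if "q \<in> trail (s # w)" for q using that by auto
    then have "Q 0" using Cons.prems by auto
    then show ?thesis using no by (intro exI[of _ "[]"] exI[of _ "s # w"]) simp
  qed
qed

text \<open>Differs from \<open>first_passage\<close> in that the start counts as a visit, so that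
  the empty prefix is among those excluded before the cut.\<close>

lemma first_visit:
  assumes "p \<in> insert 0 (trail w)" "Q p"
  shows "\<exists>u v. w = u @ v \<and> Q (shift u) \<and> (\<forall>u1 u2. u = u1 @ u2 \<longrightarrow> u2 \<noteq> [] \<longrightarrow> \<not> Q (shift u1))"
proof (cases "Q 0")
  case True
  then show ?thesis by (intro exI[of _ "[]"] exI[of _ w]) simp
next
  case False
  then have "p \<in> trail w" using assms by auto
  from first_passage[of p w Q, OF this assms(2)] obtain u s v
    where usv: "w = u @ s # v" "Q (shift (u @ [s]))" "\<forall>p\<in>trail u. \<not> Q p" by blast
  have "\<not> Q (shift u1)" if eq: "u @ [s] = u1 @ u2" "u2 \<noteq> []" for u1 u2
  proof -
    have "u = u1 @ butlast u2" using eq by (cases u2 rule: rev_cases) auto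
    then have "shift u1 \<in> insert 0 (trail u)" using shift_prefix_in_trail[of u1 "butlast u2"] by simp
    then show ?thesis using usv(3) False by auto
  qed
  then show ?thesis using usv by (intro exI[of _ "u @ [s]"] exI[of _ v]) simp
qed

section \<open>Words in the wreath product\<close>

locale wreath_generated = H: group H + generated_group "wreath_int H" S
  for H :: "('a, 'b) monoid_scheme" and S :: "((int \<Rightarrow> 'a) \<times> int) set"
begin

abbreviation W :: "((int \<Rightarrow> 'a) \<times> int) monoid"
  where "W \<equiv> wreath_int H"

text \<open>
  With \<open>(f, k)(g, l) = (j \<mapsto> f(j) g(j + k), k + l)\<close>, a cursor at \<open>k\<close> acts on the coordinate \<open>-k\<close>. Sites are
  therefore negated coordinates, so that they move along with the cursor.
\<close>

definition sites :: "(int \<Rightarrow> 'a) \<times> int \<Rightarrow> int set"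
  where "sites g = {i. fst g (- i) \<noteq> \<one>\<^bsub>H\<^esub>}"

lemma wreath_mult: "g \<otimes>\<^bsub>W\<^esub> h = (\<lambda>j. fst g j \<otimes>\<^bsub>H\<^esub> fst h (j + snd g), snd g + snd h)"
  by (simp add: wreath_int_def semidirect_product_def restrict_UNIV split: prod.split)

lemma snd_mult [simp]: "snd (g \<otimes>\<^bsub>W\<^esub> h) = snd g + snd h"
  by (simp add: wreath_mult)

lemma fst_mult: "fst (g \<otimes>\<^bsub>W\<^esub> h) j = fst g j \<otimes>\<^bsub>H\<^esub> fst h (j + snd g)"
  by (simp add: wreath_mult)

lemma wreath_one: "\<one>\<^bsub>W\<^esub> = (\<lambda>_. \<one>\<^bsub>H\<^esub>, 0)"
  by (simp add: wreath_int_def semidirect_product_def restrict_UNIV)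

lemma wreath_carrier:
  "g \<in> carrier W \<longleftrightarrow> (\<forall>j. fst g j \<in> carrier H) \<and> finite {j. fst g j \<noteq> \<one>\<^bsub>H\<^esub>}"
  by (cases g) (auto simp: wreath_int_def semidirect_product_def carrier_sum_group H.is_group PiE_UNIV_domain)

lemma fst_closed [simp]: "g \<in> carrier W \<Longrightarrow> fst g j \<in> carrier H"
  by (simp add: wreath_carrier)

lemma sites_finite: "g \<in> carrier W \<Longrightarrow> finite (sites g)"
proof -
  assume "g \<in> carrier W"
  moreover have "sites g = uminus ` {j. fst g j \<noteq> \<one>\<^bsub>H\<^esub>}"
    by (auto simp: sites_def image_iff) (metis minus_minus)
  ultimately show ?thesis by (simp add: wreath_carrier)
qed

lemma sites_mult:
  assumes "g \<in> carrier W" "h \<in> carrier W" "i \<in> sites (g \<otimes>\<^bsub>W\<^esub> h)"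
  shows "i \<in> sites g \<or> i - snd g \<in> sites h"
  using assms by (auto simp: sites_def fst_mult)

lemma snd_wval [simp]: "snd (wval w) = shift w"
  by (induction w) (simp_all add: wreath_one)

lemma snd_inv: "g \<in> carrier W \<Longrightarrow> snd (inv\<^bsub>W\<^esub> g) = - snd g"
proof -
  assume "g \<in> carrier W"
  then have "snd (inv\<^bsub>W\<^esub> g \<otimes>\<^bsub>W\<^esub> g) = 0" by (simp add: wreath_one)
  then show ?thesis by simp
qed

lemma shift_winv: "w \<in> words \<Longrightarrow> shift (winv w) = - shift w"
  by (metis snd_inv snd_wval wval_closed wval_winv)

text \<open>The inverse word runs the path backwards, with positions measured from its end point. A
  nonempty prefix of it leaves a proper prefix of \<open>w\<close>, hence
  \<open>v \<noteq> []\<close>.\<close>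

lemma trail_winv:
  assumes w: "w \<in> words" and p: "p \<in> trail (winv w)"
  shows "\<exists>u v. w = u @ v \<and> v \<noteq> [] \<and> p = shift u - shift w"
proof -
  obtain u v where uv: "winv w = u @ v" "u \<noteq> []" "p = shift u" using p trail_iff by blast
  have uw: "u \<in> words" using uv(1) w winv_words words_append by metis
  have "w = winv v @ winv u" using winv_winv[OF w] uv(1) by (simp add: winv_append)
  moreover have "winv u \<noteq> []" using uv(2) length_winv by (metis length_0_conv)
  moreover have "p = - shift (winv u)" using uv(3) shift_winv[OF uw] by simp
  ultimately show ?thesis by (intro exI[of _ "winv v"] exI[of _ "winv u"]) simp
qed

end

section \<open>Moving lamps\<close>

text \<open>\<open>D\<close> bounds both the step of a letter and the reach of its lamps;
  \<open>C\<close> pays for switching one lamp within reach of the cursor, or for one pad. The sites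
  of a bridge overhang its span by at most \<open>D\<close> at either end, so a shift by
  \<open>2 * D + 1\<close> separates consecutive bridges.\<close>

locale lamp_words = wreath_generated +
  fixes a :: 'a and D C :: nat
  assumes a_closed: "a \<in> carrier H" and a_nontrivial: "a \<noteq> \<one>\<^bsub>H\<^esub>"
    and letter_shift: "s \<in> S \<union> m_inv (wreath_int H) ` S \<Longrightarrow> \<bar>snd s\<bar> \<le> int D"
    and letter_sites: "s \<in> S \<union> m_inv (wreath_int H) ` S \<Longrightarrow> sites s \<subseteq> {- int D..int D}"
    and lamp_near: "\<bar>d\<bar> \<le> int D \<Longrightarrow>
      \<exists>w\<in>words. wval w = (\<lambda>j. if - j = d then a else \<one>\<^bsub>H\<^esub>, 0) \<and> length w \<le> C"
    and pad_near: "\<sigma> \<in> {1, -1} \<Longrightarrow> len (\<lambda>_. \<one>\<^bsub>H\<^esub>, \<sigma> * (2 * int D + 1)) \<le> C"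
begin

text \<open>Radius around a site that contains the detour for its lamp: the detour starts within
  \<open>D\<close> of the site, and a word of length at most \<open>C\<close> strays at most
  \<open>D * C\<close>.\<close>

definition K :: int
  where "K = int D + int D * int C"

definition lamp :: "int set \<Rightarrow> (int \<Rightarrow> 'a) \<times> int"
  where "lamp Y = (\<lambda>j. if - j \<in> Y then a else \<one>\<^bsub>H\<^esub>, 0)"

lemma K_ge: "int D \<le> K" "0 \<le> K"
  by (simp_all add: K_def)

lemma lamp_closed: "finite Y \<Longrightarrow> lamp Y \<in> carrier W"
proof -
  assume "finite Y"
  moreover have "{j. - j \<in> Y} = uminus ` Y" by (auto simp: image_iff) (metis minus_minus)
  ultimately show ?thesis using a_closed by (auto simp: wreath_carrier lamp_def intro: rev_finite_subset)
qed

lemma lamp_inj: "lamp Y = lamp Z \<longleftrightarrow> Y = Z"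
proof
  assume "lamp Y = lamp Z"
  then have "- (- i) \<in> Y \<longleftrightarrow> - (- i) \<in> Z" for i
    using a_nontrivial unfolding lamp_def prod.inject fun_eq_iff by (metis (full_types))
  then show "Y = Z" by auto
qed simp

lemma lamp_empty: "lamp {} = \<one>\<^bsub>W\<^esub>"
  by (simp add: lamp_def wreath_one)

lemma lamp_insert: "y \<notin> Y \<Longrightarrow> lamp (insert y Y) = lamp {y} \<otimes>\<^bsub>W\<^esub> lamp Y"
  using a_closed by (auto simp: lamp_def wreath_mult fun_eq_iff)

lemma trail_bound: "w \<in> words \<Longrightarrow> p \<in> trail w \<Longrightarrow> \<bar>p\<bar> \<le> int D * int (length w)"
proof (induction w arbitrary: p)
  case (Cons s w)
  have s: "\<bar>snd s\<bar> \<le> int D" using Cons.prems(1) letter_shift unfolding words_Cons by blast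
  have w: "w \<in> words" using Cons.prems(1) by (simp add: words_Cons)
  have "p = snd s \<or> (\<exists>q\<in>trail w. p = snd s + q)" using Cons.prems(2) by auto
  then show ?case
  proof
    assume "p = snd s"
    moreover have "0 \<le> int D * int (length w)" by simp
    ultimately show ?thesis using s by (simp add: distrib_left add_increasing2)
  next
    assume "\<exists>q\<in>trail w. p = snd s + q"
    then obtain q where "q \<in> trail w" "p = snd s + q" by blast
    then show ?thesis using Cons.IH[OF w, of q] s
      by (simp add: distrib_left)
  qed
qed simp

text \<open>A letter acts from the position before its own step, hence \<open>butlast\<close>: the
  end point of the path touches nothing yet. This matters when the last letter is the one that comes
  near a site.\<close>

lemma sites_wval:
  assumes "w \<in> words" "i \<in> sites (wval w)"
  shows "\<exists>p\<in>insert 0 (trail (butlast w)). \<bar>i - p\<bar> \<le> int D"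
  using assms
proof (induction w arbitrary: i)
  case Nil
  then show ?case by (simp add: sites_def wreath_one)
next
  case (Cons s w)
  have s: "s \<in> S \<union> m_inv W ` S" and w: "w \<in> words"
    using Cons.prems(1) unfolding words_Cons by blast+
  have "s \<in> carrier W" using s letters_closed by blast
  then consider "i \<in> sites s" | "i - snd s \<in> sites (wval w)"
    using sites_mult[of s "wval w" i] Cons.prems(2) w by auto
  then show ?case
  proof cases
    case 1
    then have "i \<in> {- int D..int D}" using letter_sites[OF s] by blast
    then have "\<bar>i - 0\<bar> \<le> int D" by auto
    then show ?thesis by blast
  next
    case 2
    then have "w \<noteq> []" by (auto simp: sites_def wreath_one)
    from Cons.IH[OF w 2] obtain p where p: "p \<in> insert 0 (trail (butlast w))" "\<bar>i - snd s - p\<bar> \<le> int D"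
      by blast
    then have "snd s + p \<in> trail (butlast (s # w))" using \<open>w \<noteq> []\<close> by auto
    moreover have "\<bar>i - (snd s + p)\<bar> \<le> int D" using p(2) by (simp add: algebra_simps)
    ultimately show ?thesis by blast
  qed
qed

text \<open>
  The lamp is inserted when the cursor first comes near \<open>y\<close>. The path up to then has not touched the
  site \<open>y\<close>, so the inserted lamp commutes to the front.
\<close>

lemma modify_site:
  assumes \<sigma>: "\<sigma> \<in> {1, -1}" and w: "w \<in> words" and y: "K < \<sigma> * y"
    and reach: "\<exists>p\<in>trail w. \<sigma> * y \<le> \<sigma> * p"
  shows "\<exists>w'\<in>words. wval w' = lamp {y} \<otimes>\<^bsub>W\<^esub> wval w \<and> length w' \<le> length w + C \<and>
    trail w \<subseteq> trail w' \<and> trail w' \<subseteq> trail w \<union> {y - K..y + K}"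
proof -
  obtain p0 where p0: "p0 \<in> trail w" "\<sigma> * y \<le> \<sigma> * p0" using reach by blast
  then have "\<sigma> * y - int D \<le> \<sigma> * p0" by simp
  from first_passage[OF p0(1), of "\<lambda>p. \<sigma> * y - int D \<le> \<sigma> * p", OF this]
  obtain u s v where usv: "w = u @ s # v" "\<sigma> * y - int D \<le> \<sigma> * shift (u @ [s])"
    "\<forall>p\<in>trail u. \<not> \<sigma> * y - int D \<le> \<sigma> * p" by blast
  define w1 where "w1 = u @ [s]"
  have w1v: "w = w1 @ v" "w1 \<in> words" "v \<in> words"
    using usv(1) w by (auto simp: w1_def words_Cons)
  have s: "s \<in> S \<union> m_inv W ` S" using usv(1) w unfolding usv(1) words_append words_Cons by blast
  \<comment> \<open>The start is also below the threshold, because \<open>D \<le> K\<close> and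
    \<open>K < \<sigma> * y\<close>.\<close>
  have before: "\<sigma> * p < \<sigma> * y - int D" if "p \<in> insert 0 (trail u)" for p
    using that usv(3) y K_ge by force
  define q where "q = shift w1"
  \<comment> \<open>The position before \<open>s\<close> was below the threshold and one letter
    moves at most \<open>D\<close>, so the cursor has not passed \<open>y\<close>.\<close>
  have near: "\<bar>y - q\<bar> \<le> int D"
  proof -
    have "\<sigma> * shift u < \<sigma> * y - int D" using before[OF shift_in_trail] .
    then show ?thesis using usv(2) letter_shift[OF s] \<sigma> by (auto simp: q_def w1_def)
  qed
  have untouched: "y \<notin> sites (wval w1)"
  proof
    assume "y \<in> sites (wval w1)"
    from sites_wval[OF w1v(2) this] obtain p where "p \<in> insert 0 (trail u)" "\<bar>y - p\<bar> \<le> int D"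
      unfolding w1_def butlast_snoc by blast
    then show False using before[of p] \<sigma> by auto
  qed
  obtain x where x: "x \<in> words" "wval x = lamp {y - q}" "length x \<le> C"
    using lamp_near[OF near] by (auto simp: lamp_def)
  have sx: "shift x = 0" using snd_wval[of x] x(2) by (simp add: lamp_def)
  \<comment> \<open>From cursor position \<open>q\<close> the lamp at \<open>y - q\<close> acts on
    the site \<open>y\<close>, where \<open>wval w1\<close> is still trivial.\<close>
  have comm: "wval w1 \<otimes>\<^bsub>W\<^esub> lamp {y - q} = lamp {y} \<otimes>\<^bsub>W\<^esub> wval w1"
  proof -
    have "fst (wval w1) (- y) = \<one>\<^bsub>H\<^esub>" using untouched by (simp add: sites_def)
    moreover have "snd (wval w1) = q" by (simp add: q_def)
    moreover have "- (j + q) = y - q \<longleftrightarrow> j = - y" for j by auto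
    moreover have "- j = y \<longleftrightarrow> j = - y" for j by auto
    ultimately show ?thesis
      using a_closed w1v(2) by (auto simp: wreath_mult lamp_def fun_eq_iff)
  qed
  define w' where "w' = w1 @ x @ v"
  have w'w: "w' \<in> words" using w1v x by (simp add: w'_def)
  moreover have "wval w' = lamp {y} \<otimes>\<^bsub>W\<^esub> wval w"
  proof -
    have "wval w' = (wval w1 \<otimes>\<^bsub>W\<^esub> lamp {y - q}) \<otimes>\<^bsub>W\<^esub> wval v"
      using w1v x lamp_closed by (simp add: w'_def wval_append m_assoc)
    also have "\<dots> = lamp {y} \<otimes>\<^bsub>W\<^esub> wval w"
      unfolding comm using w1v lamp_closed by (simp add: wval_append m_assoc)
    finally show ?thesis .
  qed
  moreover have "length w' \<le> length w + C" using w1v x by (simp add: w'_def)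
  moreover have "trail w' = trail w \<union> (+) q ` trail x"
    using w1v(1) sx by (auto simp: w'_def trail_append q_def image_Un image_image)
  moreover have "(+) q ` trail x \<subseteq> {y - K..y + K}"
  proof
    fix p assume "p \<in> (+) q ` trail x"
    then obtain r where r: "r \<in> trail x" "p = q + r" by blast
    have "\<bar>r\<bar> \<le> int D * int (length x)" by (rule trail_bound[OF x(1) r(1)])
    also have "\<dots> \<le> int D * int C" using x(3) by (intro mult_left_mono) auto
    finally show "p \<in> {y - K..y + K}" using near r(2) by (auto simp: K_def)
  qed
  ultimately show ?thesis by (intro bexI[of _ w']) auto
qed

text \<open>The margin \<open>K\<close> keeps the detour for each of these sites strictly between
  the start and level \<open>A\<close>.\<close>

definition levels :: "int \<Rightarrow> nat \<Rightarrow> int set"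
  where "levels \<sigma> A = {y. K < \<sigma> * y \<and> \<sigma> * y + K < int A}"

text \<open>Each inserted lamp only enlarges the trail, and only inside the open interval, so the
  reach required for the next lamp persists.\<close>

lemma modify_sites:
  assumes \<sigma>: "\<sigma> \<in> {1, -1}" and w: "w \<in> words"
    and Y: "finite Y" "Y \<subseteq> levels \<sigma> A"
    and reach: "\<exists>p\<in>insert 0 (trail w). int A \<le> \<sigma> * p"
  shows "\<exists>w'\<in>words. wval w' = lamp Y \<otimes>\<^bsub>W\<^esub> wval w \<and> length w' \<le> length w + C * card Y \<and>
    trail w \<subseteq> trail w' \<and> trail w' \<subseteq> trail w \<union> {p. 0 < \<sigma> * p \<and> \<sigma> * p < int A}"
  using Y
proof (induction Y)
  case empty
  then show ?case using w by (auto simp: lamp_empty intro!: bexI[of _ w])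
next
  case (insert y Y)
  then obtain w1 where w1: "w1 \<in> words" "wval w1 = lamp Y \<otimes>\<^bsub>W\<^esub> wval w" "length w1 \<le> length w + C * card Y"
    "trail w \<subseteq> trail w1" "trail w1 \<subseteq> trail w \<union> {p. 0 < \<sigma> * p \<and> \<sigma> * p < int A}" by auto
  have y: "K < \<sigma> * y" "\<sigma> * y + K < int A" using insert.prems by (auto simp: levels_def)
  have "\<exists>p\<in>trail w1. \<sigma> * y \<le> \<sigma> * p"
  proof -
    obtain p where p: "p \<in> insert 0 (trail w)" "int A \<le> \<sigma> * p" using reach by blast
    have "p \<noteq> 0" using p(2) y K_ge by auto
    then show ?thesis using p y K_ge w1(4) by (intro bexI[of _ p]) auto
  qed
  from modify_site[OF \<sigma> w1(1) y(1) this] obtain w2 where w2: "w2 \<in> words"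
    "wval w2 = lamp {y} \<otimes>\<^bsub>W\<^esub> wval w1" "length w2 \<le> length w1 + C" "trail w1 \<subseteq> trail w2"
    "trail w2 \<subseteq> trail w1 \<union> {y - K..y + K}" by blast
  have "wval w2 = lamp (insert y Y) \<otimes>\<^bsub>W\<^esub> wval w"
    using w2(2) w1(2) insert.hyps w lamp_closed by (simp add: lamp_insert[OF insert.hyps(2)] m_assoc)
  moreover have "length w2 \<le> length w + C * card (insert y Y)" using w2(3) w1(3) insert.hyps by simp
  moreover have "{y - K..y + K} \<subseteq> {p. 0 < \<sigma> * p \<and> \<sigma> * p < int A}" using \<sigma> y by auto
  ultimately show ?case using w2 w1 by (intro bexI[of _ w2]) blast+
qed

text \<open>The analogue of a half-space walk. \<open>A\<close> is the exact range, attained on the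
  path; as the start counts here, the empty word has range 0.\<close>

definition half_words :: "int \<Rightarrow> nat \<Rightarrow> ((int \<Rightarrow> 'a) \<times> int) list set"
  where "half_words \<sigma> A = {w \<in> words. (\<forall>p\<in>trail w. 0 < \<sigma> * p \<and> \<sigma> * p \<le> int A) \<and>
    (\<exists>p\<in>insert 0 (trail w). \<sigma> * p = int A)}"

text \<open>The lower inequality is weak because a bridge cut out of a closed word may revisit its
  starting level.\<close>

definition bridges :: "int \<Rightarrow> nat \<Rightarrow> ((int \<Rightarrow> 'a) \<times> int) list set"
  where "bridges \<sigma> A = {w \<in> words. (\<forall>p\<in>trail w. 0 \<le> \<sigma> * p \<and> \<sigma> * p \<le> int A) \<and> shift w = \<sigma> * int A}"

lemma modify_half:
  assumes \<sigma>: "\<sigma> \<in> {1, -1}" and w: "w \<in> half_words \<sigma> A" and Y: "finite Y" "Y \<subseteq> levels \<sigma> A"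
  shows "\<exists>w'\<in>half_words \<sigma> A. wval w' = lamp Y \<otimes>\<^bsub>W\<^esub> wval w \<and> length w' \<le> length w + C * card Y"
proof -
  have "w \<in> words" "\<exists>p\<in>insert 0 (trail w). int A \<le> \<sigma> * p"
    using w by (auto simp: half_words_def dest: eq_refl[OF sym])
  from modify_sites[OF \<sigma> this(1) Y this(2)] obtain w' where w': "w' \<in> words"
    "wval w' = lamp Y \<otimes>\<^bsub>W\<^esub> wval w" "length w' \<le> length w + C * card Y" "trail w \<subseteq> trail w'"
    "trail w' \<subseteq> trail w \<union> {p. 0 < \<sigma> * p \<and> \<sigma> * p < int A}" by blast
  have "0 < \<sigma> * p \<and> \<sigma> * p \<le> int A" if "p \<in> trail w'" for p
    using that w'(5) w by (auto simp: half_words_def)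
  moreover have "\<exists>p\<in>insert 0 (trail w'). \<sigma> * p = int A"
    using w'(4) w unfolding half_words_def by blast
  ultimately have "w' \<in> half_words \<sigma> A" using w'(1) by (simp add: half_words_def)
  then show ?thesis using w' by blast
qed

lemma modify_bridge:
  assumes \<sigma>: "\<sigma> \<in> {1, -1}" and w: "w \<in> bridges \<sigma> T" and AT: "A \<le> T"
    and Y: "finite Y" "Y \<subseteq> levels \<sigma> A"
  shows "\<exists>w'\<in>bridges \<sigma> T. wval w' = lamp Y \<otimes>\<^bsub>W\<^esub> wval w \<and> length w' \<le> length w + C * card Y"
proof -
  have ww: "w \<in> words" using w by (auto simp: bridges_def)
  have "\<sigma> * shift w = int T" using w \<sigma> by (auto simp: bridges_def)
  then have "\<exists>p\<in>insert 0 (trail w). int A \<le> \<sigma> * p"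
    using AT shift_in_trail by (intro bexI[of _ "shift w"]) auto
  from modify_sites[OF \<sigma> ww Y this] obtain w' where w': "w' \<in> words"
    "wval w' = lamp Y \<otimes>\<^bsub>W\<^esub> wval w" "length w' \<le> length w + C * card Y" "trail w \<subseteq> trail w'"
    "trail w' \<subseteq> trail w \<union> {p. 0 < \<sigma> * p \<and> \<sigma> * p < int A}" by blast
  have "shift w' = shift w" using snd_wval[of w'] unfolding w'(2) by (simp add: lamp_def)
  moreover have "0 \<le> \<sigma> * p \<and> \<sigma> * p \<le> int T" if p: "p \<in> trail w'" for p
  proof -
    have "p \<in> trail w \<or> 0 < \<sigma> * p \<and> \<sigma> * p < int A" using p w'(5) by blast
    then show ?thesis
    proof
      assume "p \<in> trail w"
      then show ?thesis using w by (simp add: bridges_def)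
    next
      assume "0 < \<sigma> * p \<and> \<sigma> * p < int A"
      then show ?thesis using AT by linarith
    qed
  qed
  ultimately have "w' \<in> bridges \<sigma> T" using w w'(1) by (simp add: bridges_def)
  then show ?thesis using w' by blast
qed

lemma winv_bridge:
  assumes \<sigma>: "\<sigma> \<in> {1, -1}" and w: "w \<in> bridges \<sigma> T"
  shows "winv w \<in> bridges (- \<sigma>) T"
proof -
  have ww: "w \<in> words" and sw: "shift w = \<sigma> * int T" using w by (auto simp: bridges_def)
  have "0 \<le> - \<sigma> * p \<and> - \<sigma> * p \<le> int T" if p: "p \<in> trail (winv w)" for p
  proof -
    obtain u v where uv: "w = u @ v" "p = shift u - shift w" using trail_winv[OF ww p] by blast
    have "0 \<le> \<sigma> * shift u \<and> \<sigma> * shift u \<le> int T"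
      using shift_prefix_in_trail[of u v] w uv(1) by (auto simp: bridges_def)
    then show ?thesis using uv(2) sw \<sigma> by auto
  qed
  then show ?thesis using ww sw by (auto simp: bridges_def shift_winv)
qed

text \<open>Inversion turns the end of the bridge into the start of a bridge of opposite direction,
  where \<open>modify_bridge\<close> applies; inverting back puts the lamps on the right,
  inverted.\<close>

lemma modify_bridge_end:
  assumes \<sigma>: "\<sigma> \<in> {1, -1}" and w: "w \<in> bridges \<sigma> T" and AT: "A \<le> T"
    and Y: "finite Y" "Y \<subseteq> levels (- \<sigma>) A"
  shows "\<exists>w'\<in>bridges \<sigma> T. wval w' = wval w \<otimes>\<^bsub>W\<^esub> inv\<^bsub>W\<^esub> lamp Y \<and> length w' \<le> length w + C * card Y"
proof -
  have \<sigma>': "- \<sigma> \<in> {1, -1}" using \<sigma> by auto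
  have ww: "w \<in> words" using w by (auto simp: bridges_def)
  from modify_bridge[OF \<sigma>' winv_bridge[OF \<sigma> w] AT Y] obtain u where u: "u \<in> bridges (- \<sigma>) T"
    "wval u = lamp Y \<otimes>\<^bsub>W\<^esub> wval (winv w)" "length u \<le> length w + C * card Y" by auto
  have uw: "u \<in> words" using u by (auto simp: bridges_def)
  have "wval (winv u) = wval w \<otimes>\<^bsub>W\<^esub> inv\<^bsub>W\<^esub> lamp Y"
    using u(2) uw ww lamp_closed[OF Y(1)] by (simp add: wval_winv inv_mult_group)
  moreover have "winv u \<in> bridges \<sigma> T" using winv_bridge[OF \<sigma>' u(1)] by simp
  ultimately show ?thesis using u(3) by (intro bexI[of _ "winv u"]) auto
qed

end

section \<open>The gain from moving lamps across junctions\<close>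

lemma sum_Pow_card:
  fixes c :: real
  assumes "finite L"
  shows "(\<Sum>Y\<in>Pow L. c ^ card Y) = (1 + c) ^ card L"
proof -
  have "(1 + c) ^ card L = (\<Prod>i\<in>L. c + 1)" by (simp add: add.commute)
  also have "\<dots> = (\<Sum>Y\<in>Pow L. (\<Prod>i\<in>Y. c) * (\<Prod>i\<in>L - Y. 1))" by (rule prod_add[OF assms])
  finally show ?thesis by simp
qed

context lamp_words
begin

lemma levels_eq: "\<sigma> \<in> {1, -1} \<Longrightarrow> levels \<sigma> A = (*) \<sigma> ` {K<..<int A - K}"
  by (auto simp: levels_def image_iff intro: bexI[of _ "- _"])

lemma finite_levels: "\<sigma> \<in> {1, -1} \<Longrightarrow> finite (levels \<sigma> A)"
  by (simp add: levels_eq)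

lemma card_levels:
  assumes "\<sigma> \<in> {1, -1}"
  shows "A \<le> card (levels \<sigma> A) + nat (2 * K + 1)"
proof -
  have "inj_on ((*) \<sigma>) {K<..<int A - K}" using assms by (auto intro: inj_onI)
  then have "card (levels \<sigma> A) = nat (int A - K - (K + 1))"
    using assms by (simp add: levels_eq card_image)
  then show ?thesis using K_ge by linarith
qed

text \<open>
  The three elements keep their product when lamps are moved across the two junctions, so every
  choice of a set of levels at each junction yields a different triple for the same word.
\<close>

lemma junction_bound:
  fixes z :: real
  assumes \<sigma>: "\<sigma> \<in> {1, -1}" and z: "0 < z" "z \<le> 1" and A: "A1 \<le> T" "A3 \<le> T"
    and bounds: "wbound z (half_words \<sigma> A1) M1" "wbound z (bridges \<sigma> T) M2"
      "wbound z (half_words (- \<sigma>) A3) M3"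
    and factor: "\<And>w. w \<in> U \<Longrightarrow> \<exists>w1 w2 w3. w = w1 @ w2 @ w3 \<and> w1 \<in> words \<and>
      winv w1 \<in> half_words \<sigma> A1 \<and> w2 \<in> bridges \<sigma> T \<and> w3 \<in> half_words (- \<sigma>) A3"
  shows "wbound z U (M1 * M2 * M3 / (1 + z ^ (2 * C)) ^ (card (levels \<sigma> A1) + card (levels (- \<sigma>) A3)))"
proof (rule wboundI)
  fix V assume V: "finite V" "V \<subseteq> U" "inj_on wval V"
  have \<sigma>': "- \<sigma> \<in> {1, -1}" using \<sigma> by auto
  define I where "I = Pow (levels \<sigma> A1) \<times> Pow (levels (- \<sigma>) A3)"
  have I: "finite I" using \<sigma> \<sigma>' by (simp add: I_def finite_levels)
  \<comment> \<open>Each moved lamp is paid for twice, once in each of the two factors that meet at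
    its junction.\<close>
  define c :: "int set \<times> int set \<Rightarrow> nat" where "c = (\<lambda>(Y, Y'). 2 * C * (card Y + card Y'))"
  \<comment> \<open>The first factor is replaced by its inverse, so that both one-sided words start
    at their junction with the bridge.\<close>
  have "\<exists>w1 w2 w3. wval w = inv\<^bsub>W\<^esub> wval w1 \<otimes>\<^bsub>W\<^esub> wval w2 \<otimes>\<^bsub>W\<^esub> wval w3 \<and>
      length w = length w1 + length w2 + length w3 \<and>
      w1 \<in> half_words \<sigma> A1 \<and> w2 \<in> bridges \<sigma> T \<and> w3 \<in> half_words (- \<sigma>) A3" if "w \<in> V" for w
  proof -
    have "w \<in> U" using that V(2) by blast
    from factor[OF this] obtain w1 w2 w3 where w: "w = w1 @ w2 @ w3" "w1 \<in> words"
      "winv w1 \<in> half_words \<sigma> A1" "w2 \<in> bridges \<sigma> T" "w3 \<in> half_words (- \<sigma>) A3" by blast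
    moreover have "w2 \<in> words" "w3 \<in> words" using w by (auto simp: bridges_def half_words_def)
    ultimately show ?thesis
      by (intro exI[of _ "winv w1"] exI[of _ w2] exI[of _ w3]) (simp add: wval_append wval_winv m_assoc)
  qed
  then obtain f1 f2 f3 where f: "\<And>w. w \<in> V \<Longrightarrow> wval w = inv\<^bsub>W\<^esub> wval (f1 w) \<otimes>\<^bsub>W\<^esub> wval (f2 w) \<otimes>\<^bsub>W\<^esub> wval (f3 w) \<and>
      length w = length (f1 w) + length (f2 w) + length (f3 w) \<and>
      f1 w \<in> half_words \<sigma> A1 \<and> f2 w \<in> bridges \<sigma> T \<and> f3 w \<in> half_words (- \<sigma>) A3"
    by metis
  have fw: "f1 w \<in> words" "f2 w \<in> words" "f3 w \<in> words" if "w \<in> V" for w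
    using f[OF that] by (auto simp: bridges_def half_words_def)
  have "\<exists>x1 x2 x3. x1 \<in> half_words \<sigma> A1 \<and> x2 \<in> bridges \<sigma> T \<and> x3 \<in> half_words (- \<sigma>) A3 \<and>
      length x1 + length x2 + length x3 \<le> length w + c i \<and>
      wval x1 = lamp (fst i) \<otimes>\<^bsub>W\<^esub> wval (f1 w) \<and>
      wval x2 = lamp (fst i) \<otimes>\<^bsub>W\<^esub> wval (f2 w) \<otimes>\<^bsub>W\<^esub> inv\<^bsub>W\<^esub> lamp (snd i) \<and>
      wval x3 = lamp (snd i) \<otimes>\<^bsub>W\<^esub> wval (f3 w)" if w: "w \<in> V" and i: "i \<in> I" for w i
  proof -
    obtain Y Y' where Y: "i = (Y, Y')" "Y \<subseteq> levels \<sigma> A1" "Y' \<subseteq> levels (- \<sigma>) A3"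
      using i by (auto simp: I_def)
    have fY: "finite Y" "finite Y'" using Y \<sigma> \<sigma>' finite_levels finite_subset by blast+
    have fm: "f1 w \<in> half_words \<sigma> A1" "f2 w \<in> bridges \<sigma> T" "f3 w \<in> half_words (- \<sigma>) A3"
      using f[OF w] by auto
    obtain x1 where x1: "x1 \<in> half_words \<sigma> A1" "wval x1 = lamp Y \<otimes>\<^bsub>W\<^esub> wval (f1 w)"
      "length x1 \<le> length (f1 w) + C * card Y" using modify_half[OF \<sigma> fm(1) fY(1) Y(2)] by blast
    obtain x3 where x3: "x3 \<in> half_words (- \<sigma>) A3" "wval x3 = lamp Y' \<otimes>\<^bsub>W\<^esub> wval (f3 w)"
      "length x3 \<le> length (f3 w) + C * card Y'" using modify_half[OF \<sigma>' fm(3) fY(2) Y(3)] by blast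
    obtain x where x: "x \<in> bridges \<sigma> T" "wval x = lamp Y \<otimes>\<^bsub>W\<^esub> wval (f2 w)"
      "length x \<le> length (f2 w) + C * card Y" using modify_bridge[OF \<sigma> fm(2) A(1) fY(1) Y(2)] by blast
    obtain x2 where x2: "x2 \<in> bridges \<sigma> T" "wval x2 = wval x \<otimes>\<^bsub>W\<^esub> inv\<^bsub>W\<^esub> lamp Y'"
      "length x2 \<le> length x + C * card Y'" using modify_bridge_end[OF \<sigma> x(1) A(2) fY(2) Y(3)] by blast
    have "length x1 + length x2 + length x3 \<le> length w + c i"
      using x1(3) x2(3) x3(3) x(3) f[OF w] by (simp add: c_def Y(1) distrib_left)
    then show ?thesis using x1 x2 x3 x(2) Y(1)
      by (intro exI[of _ x1] exI[of _ x2] exI[of _ x3]) simp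
  qed
  then obtain p1 p2 p3 where p: "\<And>w i. w \<in> V \<Longrightarrow> i \<in> I \<Longrightarrow>
      p1 w i \<in> half_words \<sigma> A1 \<and> p2 w i \<in> bridges \<sigma> T \<and> p3 w i \<in> half_words (- \<sigma>) A3 \<and>
      length (p1 w i) + length (p2 w i) + length (p3 w i) \<le> length w + c i \<and>
      wval (p1 w i) = lamp (fst i) \<otimes>\<^bsub>W\<^esub> wval (f1 w) \<and>
      wval (p2 w i) = lamp (fst i) \<otimes>\<^bsub>W\<^esub> wval (f2 w) \<otimes>\<^bsub>W\<^esub> inv\<^bsub>W\<^esub> lamp (snd i) \<and>
      wval (p3 w i) = lamp (snd i) \<otimes>\<^bsub>W\<^esub> wval (f3 w)"
    by metis
  have lamps: "lamp (fst i) \<in> carrier W" "lamp (snd i) \<in> carrier W" if "i \<in> I" for i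
    using that finite_subset[OF _ finite_levels[OF \<sigma>]] finite_subset[OF _ finite_levels[OF \<sigma>']]
    by (auto simp: I_def intro!: lamp_closed)
  have cancel: "inv\<^bsub>W\<^esub> l \<otimes>\<^bsub>W\<^esub> (l \<otimes>\<^bsub>W\<^esub> x) = x" if "l \<in> carrier W" "x \<in> carrier W" for l x
    using that by (simp flip: m_assoc)
  have prod: "inv\<^bsub>W\<^esub> wval (p1 w i) \<otimes>\<^bsub>W\<^esub> wval (p2 w i) \<otimes>\<^bsub>W\<^esub> wval (p3 w i) = wval w"
    if "w \<in> V" "i \<in> I" for w i
    using p[OF that] f[OF that(1)] fw[OF that(1)] lamps[OF that(2)]
    by (simp add: inv_mult_group m_assoc cancel)
  \<comment> \<open>The inserted lamps cancel in the product of the three values, which thus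
    determines \<open>w\<close> within \<open>V\<close>; cancelling the values of its outer factors
    then yields both lamp sets.\<close>
  have inj: "inj_on (\<lambda>(w, i). (wval (p1 w i), wval (p2 w i), wval (p3 w i))) (V \<times> I)"
  proof (rule inj_onI, clarify)
    fix w Y Y' w' Z Z'
    assume w: "w \<in> V" "w' \<in> V" and i: "(Y, Y') \<in> I" "(Z, Z') \<in> I"
      and eq: "wval (p1 w (Y, Y')) = wval (p1 w' (Z, Z'))" "wval (p2 w (Y, Y')) = wval (p2 w' (Z, Z'))"
        "wval (p3 w (Y, Y')) = wval (p3 w' (Z, Z'))"
    have "wval w = wval w'" using prod[OF w(1) i(1)] prod[OF w(2) i(2)] eq by simp
    then have ww: "w = w'" using V(3) w by (auto simp: inj_on_def)
    have "lamp Y = lamp Z"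
      using eq(1) p[OF w(1) i(1)] p[OF w(2) i(2)] lamps[OF i(1)] lamps[OF i(2)] fw[OF w(1)] ww by simp
    moreover have "lamp Y' = lamp Z'"
      using eq(3) p[OF w(1) i(1)] p[OF w(2) i(2)] lamps[OF i(1)] lamps[OF i(2)] fw[OF w(1)] ww by simp
    ultimately show "w = w' \<and> (Y, Y') = (Z, Z')" using ww by (simp add: lamp_inj)
  qed
  have "(\<Sum>i\<in>I. z ^ c i) = (\<Sum>Y\<in>Pow (levels \<sigma> A1). (z ^ (2 * C)) ^ card Y)
      * (\<Sum>Y\<in>Pow (levels (- \<sigma>) A3). (z ^ (2 * C)) ^ card Y)"
    by (simp add: I_def c_def sum_product sum.cartesian_product distrib_left power_add
        power_mult[symmetric] case_prod_beta)
  also have "\<dots> = (1 + z ^ (2 * C)) ^ (card (levels \<sigma> A1) + card (levels (- \<sigma>) A3))"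
    using \<sigma> \<sigma>' by (simp only: sum_Pow_card[OF finite_levels] power_add)
  finally have gain: "(\<Sum>i\<in>I. z ^ c i) = (1 + z ^ (2 * C)) ^ (card (levels \<sigma> A1) + card (levels (- \<sigma>) A3))" .
  have "(\<Sum>w\<in>V. z ^ length w) * (\<Sum>i\<in>I. z ^ c i) \<le> M1 * M2 * M3"
    by (rule wbound_transfer[OF z V(1) I bounds _ inj]) (use p in auto)
  moreover have "0 < 1 + z ^ (2 * C)" using z by (simp add: add_pos_pos)
  ultimately show "(\<Sum>w\<in>V. z ^ length w)
      \<le> M1 * M2 * M3 / (1 + z ^ (2 * C)) ^ (card (levels \<sigma> A1) + card (levels (- \<sigma>) A3))"
    by (simp add: gain pos_le_divide_eq)
qed

section \<open>Uniform weight of bridges\<close>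

lemma wval_bridge_sites:
  assumes \<sigma>: "\<sigma> \<in> {1, -1}" and w: "w \<in> bridges \<sigma> T" and i: "i \<in> sites (wval w)"
  shows "- int D \<le> \<sigma> * i \<and> \<sigma> * i \<le> int T + int D"
proof -
  have "w \<in> words" using w by (simp add: bridges_def)
  from sites_wval[OF this i] obtain p where p: "p \<in> insert 0 (trail (butlast w))" "\<bar>i - p\<bar> \<le> int D" by blast
  have "trail (butlast w) \<subseteq> trail w"
    by (cases w rule: rev_cases) (auto simp: trail_append)
  then have "0 \<le> \<sigma> * p \<and> \<sigma> * p \<le> int T" using p(1) w by (auto simp: bridges_def)
  then show ?thesis using p(2) \<sigma> by auto
qed

text \<open>The sites of \<open>g\<close> end at \<open>T + D\<close>, whereas those of
  \<open>h\<close>, carried along by \<open>g\<close> and the pad, start at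
  \<open>T + D + 1\<close>. Restricting the product to sites up to \<open>T + D\<close> therefore
  recovers \<open>g\<close>, and \<open>h\<close> follows by cancellation.\<close>

lemma padded_product_inj:
  assumes \<sigma>: "\<sigma> \<in> {1, -1}"
    and g: "g \<in> carrier W" "g' \<in> carrier W" "snd g = \<sigma> * int T" "snd g' = \<sigma> * int T"
      "\<forall>i\<in>sites g. \<sigma> * i \<le> int T + int D" "\<forall>i\<in>sites g'. \<sigma> * i \<le> int T + int D"
    and h: "h \<in> carrier W" "h' \<in> carrier W"
      "\<forall>i\<in>sites h. - int D \<le> \<sigma> * i" "\<forall>i\<in>sites h'. - int D \<le> \<sigma> * i"
    and t: "t = (\<lambda>_. \<one>\<^bsub>H\<^esub>, \<sigma> * (2 * int D + 1))"
    and eq: "g \<otimes>\<^bsub>W\<^esub> (t \<otimes>\<^bsub>W\<^esub> h) = g' \<otimes>\<^bsub>W\<^esub> (t \<otimes>\<^bsub>W\<^esub> h')"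
  shows "g = g' \<and> h = h'"
proof -
  have tc: "t \<in> carrier W" by (simp add: t wreath_carrier)
  have val: "fst k j = (if \<sigma> * (- j) \<le> int T + int D then fst (k \<otimes>\<^bsub>W\<^esub> (t \<otimes>\<^bsub>W\<^esub> l)) j else \<one>\<^bsub>H\<^esub>)"
    if k: "k \<in> carrier W" "snd k = \<sigma> * int T" "\<forall>i\<in>sites k. \<sigma> * i \<le> int T + int D"
      and l: "l \<in> carrier W" "\<forall>i\<in>sites l. - int D \<le> \<sigma> * i" for k l j
  proof (cases "\<sigma> * (- j) \<le> int T + int D")
    case True
    have "fst l (j + (snd k + snd t)) = \<one>\<^bsub>H\<^esub>"
    proof (rule ccontr)
      assume "fst l (j + (snd k + snd t)) \<noteq> \<one>\<^bsub>H\<^esub>"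
      then have "- (j + snd k + snd t) \<in> sites l" by (simp only: sites_def mem_Collect_eq minus_minus add.assoc simp_thms)
      then have "- int D \<le> \<sigma> * (- (j + snd k + snd t))" using l by blast
      then show False using True \<sigma> by (auto simp: k(2) t)
    qed
    then have "fst l (j + (\<sigma> * int T + \<sigma> * (2 * int D + 1))) = \<one>\<^bsub>H\<^esub>" by (simp only: k(2) t snd_conv)
    then show ?thesis using True k(1,2) l(1) tc by (simp add: fst_mult t add.assoc)
  next
    case False
    then have "- j \<notin> sites k" using k by blast
    then show ?thesis using False by (simp add: sites_def)
  qed
  have "fst g j = fst g' j" for j
    unfolding val[OF g(1,3,5) h(1,3), of j] val[OF g(2,4,6) h(2,4), of j] eq ..
  then have gg: "g = g'" using g by (simp add: prod_eq_iff fun_eq_iff)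
  moreover have "h = h'" using eq gg g h tc by simp
  ultimately show ?thesis by simp
qed

text \<open>Padded bridges are prefixed one at a time. The lower bound on the sites is the invariant
  that \<open>padded_product_inj\<close> demands of the right factor; it makes all products
  distinct, so that their weights form part of the growth series.\<close>

lemma bridge_powers:
  fixes z :: real
  assumes \<sigma>: "\<sigma> \<in> {1, -1}" and z: "0 < z" "z \<le> 1"
    and V: "finite V" "V \<subseteq> bridges \<sigma> T" "inj_on wval V"
  shows "\<exists>Z. finite Z \<and> Z \<subseteq> carrier W \<and> (\<forall>h\<in>Z. \<forall>i\<in>sites h. - int D \<le> \<sigma> * i) \<and>
    (z ^ C * (\<Sum>w\<in>V. z ^ length w)) ^ q \<le> (\<Sum>g\<in>Z. z ^ len g)"
proof (induction q)
  case 0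
  have "sites \<one>\<^bsub>W\<^esub> = {}" by (simp add: sites_def wreath_one)
  then show ?case by (intro exI[of _ "{\<one>\<^bsub>W\<^esub>}"]) simp
next
  case (Suc q)
  then obtain Z where Z: "finite Z" "Z \<subseteq> carrier W" "\<forall>h\<in>Z. \<forall>i\<in>sites h. - int D \<le> \<sigma> * i"
    "(z ^ C * (\<Sum>w\<in>V. z ^ length w)) ^ q \<le> (\<Sum>g\<in>Z. z ^ len g)" by blast
  define t where "t = (\<lambda>_::int. \<one>\<^bsub>H\<^esub>, \<sigma> * (2 * int D + 1))"
  have tc: "t \<in> carrier W" by (simp add: t_def wreath_carrier)
  have tl: "len t \<le> C" using pad_near[OF \<sigma>] by (simp add: t_def)
  define m where "m = (\<lambda>(w, h). wval w \<otimes>\<^bsub>W\<^esub> (t \<otimes>\<^bsub>W\<^esub> h))"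
  have Vw: "w \<in> words" "shift w = \<sigma> * int T" if "w \<in> V" for w using that V(2) by (auto simp: bridges_def)
  have Vs: "\<forall>i\<in>sites (wval w). - int D \<le> \<sigma> * i \<and> \<sigma> * i \<le> int T + int D" if "w \<in> V" for w
    using that V(2) wval_bridge_sites[OF \<sigma>] by blast
  have inj: "inj_on m (V \<times> Z)"
  proof (rule inj_onI, clarify)
    fix w h w' h' assume w: "w \<in> V" "w' \<in> V" and h: "h \<in> Z" "h' \<in> Z" and eq: "m (w, h) = m (w', h')"
    have "wval w = wval w' \<and> h = h'"
      by (rule padded_product_inj[OF \<sigma>, of _ _ T _ _ t])
         (use Vw[OF w(1)] Vw[OF w(2)] Vs[OF w(1)] Vs[OF w(2)] h Z eq in \<open>auto simp: m_def t_def\<close>)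
    then show "w = w' \<and> h = h'" using V(3) w by (auto simp: inj_on_def)
  qed
  have "(z ^ C * (\<Sum>w\<in>V. z ^ length w)) ^ Suc q \<le> (z ^ C * (\<Sum>w\<in>V. z ^ length w)) * (\<Sum>g\<in>Z. z ^ len g)"
    using Z(4) z by (auto intro!: mult_left_mono mult_nonneg_nonneg sum_nonneg)
  also have "\<dots> = (\<Sum>x\<in>V \<times> Z. z ^ (length (fst x) + (C + len (snd x))))"
    by (simp add: sum_product sum.cartesian_product sum_distrib_left power_add case_prod_beta mult_ac)
  also have "\<dots> \<le> (\<Sum>x\<in>V \<times> Z. z ^ len (m x))"
  proof (rule sum_mono)
    fix x assume "x \<in> V \<times> Z"
    then obtain w h where x: "x = (w, h)" "w \<in> V" "h \<in> Z" by auto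
    have hc: "h \<in> carrier W" using x Z by blast
    have "len (m x) \<le> len (wval w) + len (t \<otimes>\<^bsub>W\<^esub> h)"
      using x Vw[OF x(2)] tc hc by (auto simp: m_def intro!: len_mult_le)
    also have "\<dots> \<le> length w + (C + len h)"
      using len_le_length[OF Vw(1)[OF x(2)]] len_mult_le[OF tc hc] tl by linarith
    finally show "z ^ (length (fst x) + (C + len (snd x))) \<le> z ^ len (m x)"
      using z by (intro power_decreasing) (auto simp: x)
  qed
  also have "\<dots> = (\<Sum>g\<in>m ` (V \<times> Z). z ^ len g)" by (simp add: sum.reindex[OF inj])
  finally have "(z ^ C * (\<Sum>w\<in>V. z ^ length w)) ^ Suc q \<le> (\<Sum>g\<in>m ` (V \<times> Z). z ^ len g)" .
  moreover have "m ` (V \<times> Z) \<subseteq> carrier W" using Vw Z(2) tc by (auto simp: m_def)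
  moreover have "- int D \<le> \<sigma> * i" if g: "g \<in> m ` (V \<times> Z)" and i: "i \<in> sites g" for g i
  proof -
    obtain x where x: "g = m x" "x \<in> V \<times> Z" using g by blast
    define w h where "w = fst x" and "h = snd x"
    with x have wh: "w \<in> V" "h \<in> Z" "g = wval w \<otimes>\<^bsub>W\<^esub> (t \<otimes>\<^bsub>W\<^esub> h)"
      by (simp_all add: m_def case_prod_beta mem_Times_iff)
    have c: "wval w \<in> carrier W" "h \<in> carrier W" using wh Vw Z by auto
    consider "i \<in> sites (wval w)" | "i - shift w - snd t \<in> sites h"
      using sites_mult[of "wval w" "t \<otimes>\<^bsub>W\<^esub> h" i] sites_mult[of t h "i - shift w"] i wh(3) c tc
      by (auto simp: sites_def t_def)
    then show ?thesis
    proof cases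
      case 1
      then show ?thesis using Vs[OF wh(1)] by blast
    next
      case 2
      then have "- int D \<le> \<sigma> * (i - shift w - snd t)" using Z(3) wh(2) by blast
      then show ?thesis using Vw[OF wh(1)] \<sigma> by (auto simp: t_def)
    qed
  qed
  ultimately show ?case using V(1) Z(1) by (intro exI[of _ "m ` (V \<times> Z)"]) blast
qed

text \<open>The bound \<open>b\<close> on the growth series may blow up as \<open>z\<close> nears
  the radius, but it bounds all powers of \<open>x\<close> at once and so forces
  \<open>x \<le> 1\<close>. The resulting bound involves neither \<open>b\<close> nor
  \<open>T\<close>.\<close>

lemma bridge_bound:
  assumes \<sigma>: "\<sigma> \<in> {1, -1}" and z: "0 < z" "z < 1 / growth_rate"
  shows "wbound z (bridges \<sigma> T) (1 / z ^ C)"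
proof (rule wboundI)
  fix V assume V: "finite V" "V \<subseteq> bridges \<sigma> T" "inj_on wval V"
  have z1: "z \<le> 1" using z growth_rate_ge_1 by (smt (verit) divide_le_eq_1)
  obtain b where b: "\<And>F. finite F \<Longrightarrow> F \<subseteq> carrier W \<Longrightarrow> (\<Sum>g\<in>F. z ^ len g) \<le> b"
    using growth_series_bounded_below_radius[OF z] by blast
  define x where "x = z ^ C * (\<Sum>w\<in>V. z ^ length w)"
  have "x ^ q \<le> b" for q
    using bridge_powers[OF \<sigma> z(1) z1 V, of q] b unfolding x_def by (meson order_trans)
  moreover have "\<exists>q. b < x ^ q" if "1 < x" using real_arch_pow[OF that] .
  ultimately have "x \<le> 1" by (meson not_le)
  then show "(\<Sum>w\<in>V. z ^ length w) \<le> 1 / z ^ C" using z by (simp add: x_def field_simps)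
qed

end

section \<open>Unfolding into bridges\<close>

text \<open>Expansion by the largest index whose \<open>c i\<close> is chosen. It solves the
  recursion in \<open>half_words_bound\<close>, where the bound at \<open>n\<close> is a sum over
  all smaller ranges.\<close>

lemma prod_one_plus_eq:
  fixes c :: "nat \<Rightarrow> real"
  shows "(\<Prod>i<n. 1 + c i) = 1 + (\<Sum>i<n. c i * (\<Prod>j<i. 1 + c j))"
  by (induction n) (simp_all add: algebra_simps)

lemma prod_one_plus_le_exp:
  fixes c :: "nat \<Rightarrow> real"
  assumes "\<And>i. 0 \<le> c i"
  shows "(\<Prod>i<n. 1 + c i) \<le> exp (\<Sum>i<n. c i)"
proof -
  have "(\<Prod>i<n. 1 + c i) \<le> (\<Prod>i<n. exp (c i))"
    using assms by (intro prod_mono) (auto simp: add_nonneg_nonneg)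
  then show ?thesis by (simp add: exp_sum)
qed

context lamp_words
begin

lemma half_words_exists:
  assumes "w \<in> words" "\<forall>p\<in>trail w. 0 < \<sigma> * p"
  shows "\<exists>A. w \<in> half_words \<sigma> A \<and> (\<forall>p\<in>insert 0 (trail w). \<sigma> * p \<le> int A) \<and>
    (\<exists>p\<in>insert 0 (trail w). \<sigma> * p = int A)"
proof -
  define P where "P = (*) \<sigma> ` insert 0 (trail w)"
  have P: "finite P" "P \<noteq> {}" "0 \<in> P" using finite_trail by (auto simp: P_def)
  define A where "A = nat (Max P)"
  \<comment> \<open>The start contributes 0 to \<open>P\<close>, so the maximum is nonnegative and
    \<open>nat\<close> loses nothing.\<close>
  have A: "int A = Max P" using Max_ge[OF P(1,3)] by (simp add: A_def)
  have le: "\<sigma> * p \<le> int A" if "p \<in> insert 0 (trail w)" for p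
    unfolding A using that P by (intro Max_ge) (auto simp: P_def)
  have "int A \<in> P" unfolding A by (rule Max_in[OF P(1,2)])
  then have "\<exists>p\<in>insert 0 (trail w). \<sigma> * p = int A" by (auto simp: P_def)
  then show ?thesis using assms le by (intro exI[of _ A]) (auto simp: half_words_def)
qed

lemma half_words_0: "half_words \<sigma> 0 = {[]}"
proof -
  have "w = []" if "w \<in> half_words \<sigma> 0" for w
    using that by (cases w) (auto simp: half_words_def)
  then show ?thesis by (auto simp: half_words_def)
qed

text \<open>The cut is at the last visit to the maximum. From there on the path stays strictly below
  the maximum and strictly above 0, so the remainder has smaller range, which drives the
  recursion.\<close>

lemma half_words_split:
  assumes \<sigma>: "\<sigma> \<in> {1, -1}" and w: "w \<in> half_words \<sigma> A" and A: "0 < A"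
  shows "\<exists>A'<A. \<exists>u v. w = u @ v \<and> u \<in> bridges \<sigma> A \<and> v \<in> half_words (- \<sigma>) A'"
proof -
  obtain p where "p \<in> insert 0 (trail w)" "\<sigma> * p = int A" using w unfolding half_words_def by blast
  from last_passage[of p w "\<lambda>p. \<sigma> * p = int A", OF this] obtain u v
    where uv: "w = u @ v" "\<sigma> * shift u = int A" "\<forall>p\<in>trail v. \<sigma> * (shift u + p) \<noteq> int A" by blast
  have words: "u \<in> words" "v \<in> words" using w uv(1) by (auto simp: half_words_def)
  have tw: "trail w = trail u \<union> (+) (shift u) ` trail v" by (simp add: uv(1) trail_append)
  have bounds: "0 < \<sigma> * p \<and> \<sigma> * p \<le> int A" if "p \<in> trail w" for p
    using that w by (simp add: half_words_def)
  have tv: "0 < - \<sigma> * p \<and> - \<sigma> * p < int A" if "p \<in> trail v" for p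
  proof -
    have "0 < \<sigma> * (shift u + p) \<and> \<sigma> * (shift u + p) \<le> int A" using that tw by (intro bounds) auto
    moreover have "\<sigma> * (shift u + p) \<noteq> int A" using that uv(3) by blast
    moreover have "\<sigma> * (shift u + p) = int A + \<sigma> * p" using uv(2) by (simp add: distrib_left)
    ultimately show ?thesis by auto
  qed
  then obtain A' p' where A': "v \<in> half_words (- \<sigma>) A'" "p' \<in> insert 0 (trail v)" "- \<sigma> * p' = int A'"
    using half_words_exists[OF words(2), of "- \<sigma>"] by blast
  have "int A' < int A" using tv[of p'] A' A by auto
  moreover have "shift u = \<sigma> * int A" using uv(2) \<sigma> by auto
  then have "u \<in> bridges \<sigma> A" using words(1) bounds tw by (auto simp: bridges_def less_imp_le)
  ultimately show ?thesis using A'(1) uv(1) by auto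
qed

text \<open>The splitting points are the first minimum and the last maximum of the \<open>\<sigma>\<close>-oriented path.\<close>

lemma closed_word_split:
  assumes \<sigma>: "\<sigma> \<in> {1, -1}" and w: "w \<in> words" "shift w = 0" "w = u @ b @ v"
    and lo: "\<forall>p\<in>insert 0 (trail w). \<sigma> * shift u \<le> \<sigma> * p"
    and hi: "\<forall>p\<in>insert 0 (trail w). \<sigma> * p \<le> \<sigma> * shift (u @ b)"
    and first: "\<forall>u1 u2. u = u1 @ u2 \<longrightarrow> u2 \<noteq> [] \<longrightarrow> shift u1 \<noteq> shift u"
    and last: "\<forall>p\<in>trail v. shift (u @ b) + p \<noteq> shift (u @ b)"
  shows "\<exists>A1 B A3 R. B \<le> A1 \<and> R \<le> A3 \<and> A1 \<le> B + R \<and> A3 \<le> B + R \<and>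
    winv u \<in> half_words \<sigma> A1 \<and> b \<in> bridges \<sigma> (B + R) \<and> v \<in> half_words (- \<sigma>) A3"
proof -
  have words: "u \<in> words" "b \<in> words" "v \<in> words" using w by auto
  have neq: "\<sigma> * x \<noteq> 0" if "x \<noteq> 0" for x using that \<sigma> by auto
  \<comment> \<open>Depth below and height above the start, in direction \<open>\<sigma>\<close>.
    Both are nonnegative because the start is among the positions.\<close>
  define B where "B = nat (- (\<sigma> * shift u))"
  define R where "R = nat (\<sigma> * shift (u @ b))"
  have B: "int B = - (\<sigma> * shift u)" using lo by (simp add: B_def)
  have R: "int R = \<sigma> * shift (u @ b)" using hi by (simp add: R_def)
  have tw: "trail w = trail u \<union> (+) (shift u) ` trail b \<union> (+) (shift (u @ b)) ` trail v"
    by (simp add: w(3) trail_append image_Un image_image add.assoc Un_assoc)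
  have range: "- int B \<le> \<sigma> * p \<and> \<sigma> * p \<le> int R" if "p \<in> insert 0 (trail w)" for p
    using lo hi that B R by auto
  \<comment> \<open>Read backwards from the first minimum, the initial part never returns to that
    level, since the minimum was not visited before.\<close>
  have tu: "0 < \<sigma> * p \<and> \<sigma> * p \<le> int (B + R)" if p: "p \<in> trail (winv u)" for p
  proof -
    obtain u1 u2 where u12: "u = u1 @ u2" "u2 \<noteq> []" "p = shift u1 - shift u"
      using trail_winv[OF words(1) p] by blast
    have "shift u1 \<in> insert 0 (trail w)" using shift_prefix_in_trail[of u1 "u2 @ b @ v"] by (simp add: u12(1) w(3))
    then have "- int B \<le> \<sigma> * shift u1 \<and> \<sigma> * shift u1 \<le> int R" by (rule range)
    moreover have "\<sigma> * p = \<sigma> * shift u1 + int B" using B u12(3) by (simp add: right_diff_distrib)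
    moreover have "\<sigma> * p \<noteq> 0" using first u12 by (intro neq) auto
    ultimately show ?thesis by auto
  qed
  have tv: "0 < - \<sigma> * p \<and> - \<sigma> * p \<le> int (B + R)" if p: "p \<in> trail v" for p
  proof -
    have "shift (u @ b) + p \<in> insert 0 (trail w)" using p tw by blast
    then have "- int B \<le> \<sigma> * (shift (u @ b) + p) \<and> \<sigma> * (shift (u @ b) + p) \<le> int R" by (rule range)
    moreover have "\<sigma> * (shift (u @ b) + p) = int R + \<sigma> * p" using R by (simp add: distrib_left)
    moreover have "\<sigma> * p \<noteq> 0" using last p by (intro neq) auto
    ultimately show ?thesis by auto
  qed
  have tb: "0 \<le> \<sigma> * p \<and> \<sigma> * p \<le> int (B + R)" if p: "p \<in> trail b" for p
  proof -
    have "shift u + p \<in> insert 0 (trail w)" using p tw by blast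
    then have "- int B \<le> \<sigma> * (shift u + p) \<and> \<sigma> * (shift u + p) \<le> int R" by (rule range)
    then show ?thesis using B by (simp add: distrib_left)
  qed
  have "\<sigma> * shift b = int (B + R)" using B R by (simp add: distrib_left)
  then have "shift b = \<sigma> * int (B + R)" using \<sigma> by auto
  then have b: "b \<in> bridges \<sigma> (B + R)" using words(2) tb by (simp add: bridges_def)
  obtain A1 where A1: "winv u \<in> half_words \<sigma> A1" "\<forall>p\<in>insert 0 (trail (winv u)). \<sigma> * p \<le> int A1"
      "\<exists>p\<in>insert 0 (trail (winv u)). \<sigma> * p = int A1"
    using half_words_exists[of "winv u" \<sigma>] words(1) tu by auto
  obtain A3 where A3: "v \<in> half_words (- \<sigma>) A3" "\<forall>p\<in>insert 0 (trail v). - \<sigma> * p \<le> int A3"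
      "\<exists>p\<in>insert 0 (trail v). - \<sigma> * p = int A3"
    using half_words_exists[of v "- \<sigma>"] words(3) tv by auto
  \<comment> \<open>The reversed initial part ends at the start of \<open>w\<close>, at height
    \<open>B\<close> above the minimum; likewise \<open>v\<close> descends from height
    \<open>R\<close> to 0 because \<open>w\<close> is closed.\<close>
  have "\<sigma> * shift (winv u) \<le> int A1" using A1(2) shift_in_trail by blast
  then have "B \<le> A1" using B by (simp add: shift_winv words(1))
  moreover have "- \<sigma> * shift v \<le> int A3" using A3(2) shift_in_trail by blast
  then have "int R \<le> int A3"
  proof -
    have "shift v = - shift (u @ b)" using w(2) by (simp add: w(3))
    then have "- \<sigma> * shift v = int R" by (simp only: R minus_mult_minus)
    then show ?thesis using \<open>- \<sigma> * shift v \<le> int A3\<close> by linarith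
  qed
  moreover have "int A1 \<le> int (B + R)"
  proof -
    obtain p where "p \<in> insert 0 (trail (winv u))" "\<sigma> * p = int A1" using A1(3) by blast
    then show ?thesis using tu[of p] by auto
  qed
  moreover have "int A3 \<le> int (B + R)"
  proof -
    obtain p where "p \<in> insert 0 (trail v)" "- \<sigma> * p = int A3" using A3(3) by blast
    then show ?thesis using tv[of p] by auto
  qed
  ultimately show ?thesis using A1(1) A3(1) b
    by (intro exI[of _ A1] exI[of _ B] exI[of _ A3] exI[of _ R]) simp
qed

text \<open>If the first minimum does not come after the last maximum, these two are the cuts, with
  \<open>\<sigma> = 1\<close>. Otherwise the first maximum does not come after the last minimum, and
  the mirrored cuts work with \<open>\<sigma> = -1\<close>.\<close>

lemma closed_word_factor:
  assumes w: "w \<in> words" "shift w = 0"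
  shows "\<exists>\<sigma>\<in>{1, -1}. \<exists>u b v A1 B A3 R. w = u @ b @ v \<and> B \<le> A1 \<and> R \<le> A3 \<and> A1 \<le> B + R \<and> A3 \<le> B + R \<and>
    winv u \<in> half_words \<sigma> A1 \<and> b \<in> bridges \<sigma> (B + R) \<and> v \<in> half_words (- \<sigma>) A3"
proof -
  define P where "P = insert 0 (trail w)"
  have P: "finite P" "P \<noteq> {}" using finite_trail by (auto simp: P_def)
  have Pin: "Min P \<in> insert 0 (trail w)" "Max P \<in> insert 0 (trail w)"
    using Min_in[OF P] Max_in[OF P] by (simp_all add: P_def)
  have Pb: "Min P \<le> p" "p \<le> Max P" if "p \<in> insert 0 (trail w)" for p
    using that P by (auto simp: P_def[symmetric])
  obtain u1 v1 where min1: "w = u1 @ v1" "shift u1 = Min P"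
      "\<forall>x y. u1 = x @ y \<longrightarrow> y \<noteq> [] \<longrightarrow> shift x \<noteq> Min P"
    using first_visit[of "Min P" w "\<lambda>p. p = Min P", OF Pin(1) refl] by blast
  obtain u2 v2 where max2: "w = u2 @ v2" "shift u2 = Max P" "\<forall>p\<in>trail v2. shift u2 + p \<noteq> Max P"
    using last_passage[of "Max P" w "\<lambda>p. p = Max P", OF Pin(2) refl] by blast
  obtain u3 v3 where max3: "w = u3 @ v3" "shift u3 = Max P"
      "\<forall>x y. u3 = x @ y \<longrightarrow> y \<noteq> [] \<longrightarrow> shift x \<noteq> Max P"
    using first_visit[of "Max P" w "\<lambda>p. p = Max P", OF Pin(2) refl] by blast
  obtain u4 v4 where min4: "w = u4 @ v4" "shift u4 = Min P" "\<forall>p\<in>trail v4. shift u4 + p \<noteq> Min P"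
    using last_passage[of "Min P" w "\<lambda>p. p = Min P", OF Pin(1) refl] by blast
  have prefix: "\<exists>b. y = x @ b" if "w = x @ x'" "w = y @ y'" "length x \<le> length y" for x x' y y'
    using that by (metis append_eq_append_conv_if append_take_drop_id)
  have ord: "length x \<le> length y"
    if xy: "w = x @ x'" "w = y @ y'" "shift y = m" "\<forall>a b. x = a @ b \<longrightarrow> b \<noteq> [] \<longrightarrow> shift a \<noteq> m" for x x' y y' m
  proof (rule ccontr)
    assume "\<not> length x \<le> length y"
    then obtain b where "x = y @ b" "b \<noteq> []" using prefix[OF xy(2,1)] by fastforce
    then show False using xy(3,4) by blast
  qed
  show ?thesis
  proof (cases "length u1 \<le> length u2")
    case True
    then obtain b where b: "u2 = u1 @ b" using prefix[OF min1(1) max2(1)] by blast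
    have "\<exists>A1 B A3 R. B \<le> A1 \<and> R \<le> A3 \<and> A1 \<le> B + R \<and> A3 \<le> B + R \<and>
      winv u1 \<in> half_words 1 A1 \<and> b \<in> bridges 1 (B + R) \<and> v2 \<in> half_words (- 1) A3"
      by (rule closed_word_split[OF _ w]) (use min1 max2 b Pb in auto)
    moreover have "w = u1 @ b @ v2" using max2(1) b by simp
    ultimately show ?thesis by blast
  next
    case False
    \<comment> \<open>First maximum, last maximum, first minimum and last minimum now occur in this
      order.\<close>
    then have "length u3 \<le> length u4"
      using ord[OF max3(1) max2(1,2) max3(3)] ord[OF min1(1) min4(1,2) min1(3)] by linarith
    then obtain b where b: "u4 = u3 @ b" using prefix[OF max3(1) min4(1)] by blast
    have "\<exists>A1 B A3 R. B \<le> A1 \<and> R \<le> A3 \<and> A1 \<le> B + R \<and> A3 \<le> B + R \<and>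
      winv u3 \<in> half_words (- 1) A1 \<and> b \<in> bridges (- 1) (B + R) \<and> v4 \<in> half_words (- (- 1)) A3"
      by (rule closed_word_split[OF _ w]) (use max3 min4 b Pb in auto)
    moreover have "w = u3 @ b @ v4" using min4(1) b by simp
    ultimately show ?thesis by blast
  qed
qed

end

section \<open>Summing over all decompositions, uniformly in the weight\<close>

locale lamp_words_weight = lamp_words +
  fixes z0 z :: real
  assumes z0: "0 < z0" "z0 \<le> z" and z_lt: "z < 1 / growth_rate"
begin

text \<open>The guaranteed gain per available level of a junction. Taking \<open>z0\<close> instead
  of \<open>z\<close> makes it uniform up to the radius.\<close>

definition \<kappa> :: real
  where "\<kappa> = 1 + z0 ^ (2 * C)"

text \<open>The bridge bound at \<open>z0\<close> times the gain forgone on \<open>2 * K + 1\<close>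
  levels at each of two junctions.\<close>

definition \<beta> :: real
  where "\<beta> = \<kappa> ^ (2 * nat (2 * K + 1)) / z0 ^ C"

lemma z_bounds: "0 < z" "z \<le> 1"
proof -
  show "0 < z" using z0 by simp
  show "z \<le> 1" using z_lt growth_rate_ge_1 by (smt (verit) divide_le_eq_1)
qed

lemma \<kappa>_gt: "1 < \<kappa>"
  using z0 by (simp add: \<kappa>_def)

lemma \<beta>_pos: "0 < \<beta>"
  using z0 \<kappa>_gt by (simp add: \<beta>_def)

text \<open>By \<open>card_levels\<close> a junction can use all but \<open>2 * K + 1\<close> levels
  of its range, and the shortfall is absorbed in \<open>\<beta>\<close>. The constants now depend on
  \<open>z0\<close> but not on \<open>z\<close>.\<close>

lemma junction_bound_uniform:
  assumes \<sigma>: "\<sigma> \<in> {1, -1}" and A: "A1 \<le> T" "A3 \<le> T"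
    and bounds: "wbound z (half_words \<sigma> A1) M1" "wbound z (half_words (- \<sigma>) A3) M3"
    and factor: "\<And>w. w \<in> U \<Longrightarrow> \<exists>w1 w2 w3. w = w1 @ w2 @ w3 \<and> w1 \<in> words \<and>
      winv w1 \<in> half_words \<sigma> A1 \<and> w2 \<in> bridges \<sigma> T \<and> w3 \<in> half_words (- \<sigma>) A3"
  shows "wbound z U (\<beta> * (1 / \<kappa>) ^ A1 * (1 / \<kappa>) ^ A3 * M1 * M3)"
proof (rule wbound_mono)
  show "wbound z U (M1 * (1 / z ^ C) * M3 / (1 + z ^ (2 * C)) ^ (card (levels \<sigma> A1) + card (levels (- \<sigma>) A3)))"
    by (rule junction_bound[OF \<sigma> z_bounds A bounds(1) bridge_bound[OF \<sigma> z_bounds(1) z_lt] bounds(2) factor])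
  define n where "n = card (levels \<sigma> A1) + card (levels (- \<sigma>) A3)"
  define L where "L = nat (2 * K + 1)"
  have "- \<sigma> \<in> {1, -1}" using \<sigma> by auto
  then have n: "A1 + A3 \<le> n + 2 * L"
    using card_levels[OF \<sigma>, of A1] card_levels[of "- \<sigma>" A3] by (simp add: n_def L_def)
  have M: "0 \<le> M1" "0 \<le> M3" using bounds wbound_nonneg by blast+
  have pos: "0 < z ^ C" "0 < z0 ^ C" "z0 ^ C \<le> z ^ C" using z_bounds z0 by (auto intro: power_mono)
  have "\<kappa> ^ (A1 + A3) \<le> \<kappa> ^ (n + 2 * L)" using n \<kappa>_gt by (intro power_increasing) auto
  also have "\<dots> = \<kappa> ^ n * \<kappa> ^ (2 * L)" by (rule power_add)
  also have "\<dots> \<le> (1 + z ^ (2 * C)) ^ n * \<kappa> ^ (2 * L)"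
    using \<kappa>_gt z0 z_bounds by (intro mult_right_mono power_mono) (auto simp: \<kappa>_def intro: power_mono)
  finally have "1 / (1 + z ^ (2 * C)) ^ n \<le> \<kappa> ^ (2 * L) / \<kappa> ^ (A1 + A3)"
    using \<kappa>_gt z_bounds by (simp add: field_simps add_pos_pos)
  moreover have "1 / z ^ C \<le> 1 / z0 ^ C" using pos by (simp add: field_simps)
  ultimately have "(1 / z ^ C) * (1 / (1 + z ^ (2 * C)) ^ n) \<le> (1 / z0 ^ C) * (\<kappa> ^ (2 * L) / \<kappa> ^ (A1 + A3))"
    using pos z_bounds \<kappa>_gt by (intro mult_mono) auto
  then have "(M1 * M3) * ((1 / z ^ C) * (1 / (1 + z ^ (2 * C)) ^ n))
      \<le> (M1 * M3) * ((1 / z0 ^ C) * (\<kappa> ^ (2 * L) / \<kappa> ^ (A1 + A3)))"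
    using M by (intro mult_left_mono) auto
  then show "M1 * (1 / z ^ C) * M3 / (1 + z ^ (2 * C)) ^ (card (levels \<sigma> A1) + card (levels (- \<sigma>) A3))
      \<le> \<beta> * (1 / \<kappa>) ^ A1 * (1 / \<kappa>) ^ A3 * M1 * M3"
    by (simp add: n_def[symmetric] L_def[symmetric] \<beta>_def power_add power_divide mult_ac)
qed

text \<open>Splitting off the bridge up to the last maximum leaves a one-sided word of smaller range
  \<open>A'\<close>, and the junction contributes a factor \<open>(1 / \<kappa>) ^ A'\<close>.
  Summing over \<open>A'\<close> gives the recursion that the product solves.\<close>

lemma half_words_bound:
  "\<sigma> \<in> {1, -1} \<Longrightarrow> wbound z (half_words \<sigma> A) (\<Prod>i<A. 1 + \<beta> * (1 / \<kappa>) ^ i)"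
proof (induction A arbitrary: \<sigma> rule: less_induct)
  case (less A)
  define c where "c i = \<beta> * (1 / \<kappa>) ^ i" for i
  have c0: "0 \<le> c i" for i using \<beta>_pos \<kappa>_gt by (simp add: c_def)
  have \<sigma>': "- \<sigma> \<in> {1, -1}" using less.prems by auto
  have zero: "wbound z (half_words \<tau> 0) 1" for \<tau>
  proof (rule wboundI)
    fix V :: "((int \<Rightarrow> 'a) \<times> int) list set"
    assume "V \<subseteq> half_words \<tau> 0"
    then have "V = {} \<or> V = {[]}" by (auto simp: half_words_0)
    then show "(\<Sum>w\<in>V. z ^ length w) \<le> 1" by auto
  qed
  show ?case
  proof (cases "A = 0")
    case True
    then show ?thesis using zero by simp
  next
    case False
    define U' where "U' A' = {w. \<exists>u v. w = u @ v \<and> u \<in> bridges \<sigma> A \<and> v \<in> half_words (- \<sigma>) A'}" for A'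
    have "wbound z (half_words \<sigma> A) (\<Prod>i<A. 1 + c i)"
    proof (rule wbound_cover[where J = "{..<A}" and U' = U' and M = "\<lambda>A'. c A' * (\<Prod>i<A'. 1 + c i)"])
      show "\<exists>j\<in>{..<A}. w \<in> U' j" if "w \<in> half_words \<sigma> A" for w
        using half_words_split[OF less.prems that] False unfolding U'_def by blast
      fix A' assume "A' \<in> {..<A}"
      then have A': "A' < A" by simp
      \<comment> \<open>Only the right junction is present; the left one-sided word is empty, of
        range 0 and weight 1.\<close>
      have "wbound z (U' A') (\<beta> * (1 / \<kappa>) ^ 0 * (1 / \<kappa>) ^ A' * 1 * (\<Prod>i<A'. 1 + \<beta> * (1 / \<kappa>) ^ i))"
      proof (rule junction_bound_uniform[OF less.prems _ _ zero less.IH[OF A' \<sigma>']])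
        fix w assume "w \<in> U' A'"
        then obtain u v where "w = u @ v" "u \<in> bridges \<sigma> A" "v \<in> half_words (- \<sigma>) A'"
          unfolding U'_def by blast
        then show "\<exists>w1 w2 w3. w = w1 @ w2 @ w3 \<and> w1 \<in> words \<and> winv w1 \<in> half_words \<sigma> 0 \<and>
            w2 \<in> bridges \<sigma> A \<and> w3 \<in> half_words (- \<sigma>) A'"
          by (intro exI[of _ "[]"] exI[of _ u] exI[of _ v]) (simp add: half_words_0 winv_def)
      qed (use A' in auto)
      then show "wbound z (U' A') (c A' * (\<Prod>i<A'. 1 + c i))" by (simp add: c_def)
    next
      fix J' :: "nat set" assume "finite J'" "J' \<subseteq> {..<A}"
      then have "(\<Sum>A'\<in>J'. c A' * (\<Prod>i<A'. 1 + c i)) \<le> (\<Sum>A'<A. c A' * (\<Prod>i<A'. 1 + c i))"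
        using c0 by (intro sum_mono2 mult_nonneg_nonneg prod_nonneg) (auto simp: add_nonneg_nonneg)
      then show "(\<Sum>A'\<in>J'. c A' * (\<Prod>i<A'. 1 + c i)) \<le> (\<Prod>i<A. 1 + c i)"
        by (simp add: prod_one_plus_eq[of c A])
    qed (use z_bounds in auto)
    then show ?thesis by (simp add: c_def)
  qed
qed

text \<open>The deviations of the factors from 1 decay geometrically, so the products stay bounded
  over all ranges.\<close>

lemma half_words_bound_uniform:
  assumes "\<sigma> \<in> {1, -1}"
  shows "wbound z (half_words \<sigma> A) (exp (\<beta> / (1 - 1 / \<kappa>)))"
proof (rule wbound_mono[OF half_words_bound[OF assms]])
  have r: "0 \<le> 1 / \<kappa>" "1 / \<kappa> < 1" using \<kappa>_gt by auto
  have "(\<Sum>i<A. (1 / \<kappa>) ^ i) \<le> suminf (\<lambda>i. (1 / \<kappa>) ^ i)"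
    using r by (intro sum_le_suminf summable_geometric) auto
  then have "(\<Sum>i<A. \<beta> * (1 / \<kappa>) ^ i) \<le> \<beta> * (1 / (1 - 1 / \<kappa>))"
    unfolding sum_distrib_left[symmetric] using r \<beta>_pos by (intro mult_left_mono) (auto simp: suminf_geometric)
  then have "exp (\<Sum>i<A. \<beta> * (1 / \<kappa>) ^ i) \<le> exp (\<beta> / (1 - 1 / \<kappa>))" by simp
  moreover have "(\<Prod>i<A. 1 + \<beta> * (1 / \<kappa>) ^ i) \<le> exp (\<Sum>i<A. \<beta> * (1 / \<kappa>) ^ i)"
    using \<beta>_pos \<kappa>_gt by (intro prod_one_plus_le_exp) auto
  ultimately show "(\<Prod>i<A. 1 + \<beta> * (1 / \<kappa>) ^ i) \<le> exp (\<beta> / (1 - 1 / \<kappa>))" by linarith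
qed

text \<open>The junction bound depends on the outer ranges only, while \<open>B \<le> A1\<close> and
  \<open>R \<le> A3\<close> leave at most \<open>Suc A1\<close> and \<open>Suc A3\<close> choices
  for the two parts of the span. The series of \<open>Suc A * r ^ A\<close> sums to
  \<open>1 / (1 - r) ^ 2\<close>, once for each end, and the two directions give the factor
  2.\<close>

lemma closed_words_bound:
  "wbound z {w \<in> words. shift w = 0} (2 * (\<beta> * exp (\<beta> / (1 - 1 / \<kappa>)) ^ 2 * (1 / (1 - 1 / \<kappa>) ^ 2) ^ 2))"
proof -
  define r where "r = 1 / \<kappa>"
  have r: "0 \<le> r" "r < 1" using \<kappa>_gt by (auto simp: r_def)
  define E where "E = exp (\<beta> / (1 - r))"
  define J :: "(int \<times> (nat \<times> nat) \<times> (nat \<times> nat)) set"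
    where "J = {(\<sigma>, (A1, B), (A3, R)). \<sigma> \<in> {1, -1} \<and> B \<le> A1 \<and> R \<le> A3 \<and> A1 \<le> B + R \<and> A3 \<le> B + R}"
  define U' :: "int \<times> (nat \<times> nat) \<times> (nat \<times> nat) \<Rightarrow> ((int \<Rightarrow> 'a) \<times> int) list set"
    where "U' = (\<lambda>(\<sigma>, (A1, B), (A3, R)). {w. \<exists>w1 w2 w3. w = w1 @ w2 @ w3 \<and> w1 \<in> words \<and>
      winv w1 \<in> half_words \<sigma> A1 \<and> w2 \<in> bridges \<sigma> (B + R) \<and> w3 \<in> half_words (- \<sigma>) A3})"
  define M :: "int \<times> (nat \<times> nat) \<times> (nat \<times> nat) \<Rightarrow> real"
    where "M = (\<lambda>(\<sigma>, x, y). \<beta> * E ^ 2 * (r ^ fst x * r ^ fst y))"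
  have E0: "0 < E" by (simp add: E_def)
  have "wbound z {w \<in> words. shift w = 0} (2 * (\<beta> * E ^ 2 * (1 / (1 - r) ^ 2) ^ 2))"
  proof (rule wbound_cover[where J = J and U' = U' and M = M])
    fix w assume "w \<in> {w \<in> words. shift w = 0}"
    then have w: "w \<in> words" "shift w = 0" by auto
    from closed_word_factor[OF this] obtain \<sigma> u b v A1 B A3 R where
      f: "\<sigma> \<in> {1, -1}" "w = u @ b @ v" "B \<le> A1" "R \<le> A3" "A1 \<le> B + R" "A3 \<le> B + R"
      "winv u \<in> half_words \<sigma> A1" "b \<in> bridges \<sigma> (B + R)" "v \<in> half_words (- \<sigma>) A3" by blast
    have "(\<sigma>, (A1, B), (A3, R)) \<in> J" using f(1,3-6) by (simp add: J_def)
    moreover have "u \<in> words" using w(1) f(2) by simp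
    then have "w \<in> U' (\<sigma>, (A1, B), (A3, R))" unfolding U'_def prod.case using f(2,7-9) by blast
    ultimately show "\<exists>j\<in>J. w \<in> U' j" by blast
  next
    fix j assume "j \<in> J"
    then obtain \<sigma> A1 B A3 R where j: "j = (\<sigma>, (A1, B), (A3, R))" "\<sigma> \<in> {1, -1}" "A1 \<le> B + R" "A3 \<le> B + R"
      by (auto simp: J_def)
    have \<sigma>': "- \<sigma> \<in> {1, -1}" using j(2) by auto
    have "wbound z (U' j) (\<beta> * (1 / \<kappa>) ^ A1 * (1 / \<kappa>) ^ A3 * E * E)"
      unfolding E_def r_def
      by (rule junction_bound_uniform[OF j(2-4) half_words_bound_uniform[OF j(2)] half_words_bound_uniform[OF \<sigma>']])
         (simp add: U'_def j(1))
    then show "wbound z (U' j) (M j)" by (simp add: M_def j(1) r_def power2_eq_square mult_ac)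
  next
    fix J' assume J': "finite J'" "J' \<subseteq> J"
    \<comment> \<open>A finite \<open>J'\<close> fits into a product of two truncated triangles of
      pairs \<open>(A, B)\<close> with \<open>B \<le> A\<close>, over which the sum factors.\<close>
    define N where "N = Max (insert 0 ((\<lambda>(\<sigma>, (A1, B), (A3, R)). max A1 A3) ` J'))"
    define \<Delta> where "\<Delta> = (SIGMA A:{..N}. {..A})"
    have fin: "finite \<Delta>" by (simp add: \<Delta>_def)
    have "J' \<subseteq> {1, -1} \<times> \<Delta> \<times> \<Delta>"
    proof
      fix j assume j: "j \<in> J'"
      then obtain \<sigma> A1 B A3 R where j': "j = (\<sigma>, (A1, B), (A3, R))" "\<sigma> \<in> {1, -1}" "B \<le> A1" "R \<le> A3"
        using J'(2) by (auto simp: J_def)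
      have "max A1 A3 \<le> N" unfolding N_def using J'(1) j j'(1) by (intro Max_ge) (auto intro!: image_eqI[of _ _ j])
      then show "j \<in> {1, -1} \<times> \<Delta> \<times> \<Delta>" using j' by (simp add: \<Delta>_def)
    qed
    then have "sum M J' \<le> sum M ({1, -1} \<times> \<Delta> \<times> \<Delta>)"
      using fin r \<beta>_pos by (intro sum_mono2) (auto simp: M_def)
    also have "\<dots> = 2 * (\<beta> * E ^ 2 * ((\<Sum>x\<in>\<Delta>. r ^ fst x) * (\<Sum>y\<in>\<Delta>. r ^ fst y)))"
      unfolding sum_product by (simp add: M_def sum.cartesian_product[symmetric] sum_distrib_left)
    also have "\<dots> \<le> 2 * (\<beta> * E ^ 2 * (1 / (1 - r) ^ 2 * (1 / (1 - r) ^ 2)))"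
    proof -
      have "(\<Sum>x\<in>\<Delta>. r ^ fst x) = (\<Sum>A\<le>N. real (Suc A) * r ^ A)"
        using sum.Sigma[of "{..N}" atMost "\<lambda>A _. r ^ A"] by (simp add: \<Delta>_def case_prod_beta)
      also have "\<dots> \<le> 1 / (1 - r) ^ 2"
      proof -
        \<comment> \<open>The derivative of the geometric series.\<close>
        have s: "(\<lambda>n. real (Suc n) * r ^ n) sums (1 / (1 - r) ^ 2)"
          using geometric_deriv_sums[of r] r by simp
        show ?thesis
          using sum_le_suminf[OF sums_summable[OF s], of "{..N}"] r sums_unique[OF s] by auto
      qed
      finally have "(\<Sum>x\<in>\<Delta>. r ^ fst x) \<le> 1 / (1 - r) ^ 2" .
      then show ?thesis using r \<beta>_pos by (intro mult_left_mono mult_mono) (auto intro: sum_nonneg)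
    qed
    finally show "sum M J' \<le> 2 * (\<beta> * E ^ 2 * (1 / (1 - r) ^ 2) ^ 2)"
      by (simp add: power2_eq_square)
  qed (use z_bounds in auto)
  then show ?thesis by (simp add: E_def r_def)
qed

end

section \<open>The base group at the radius of convergence\<close>

context wreath_generated
begin

lemma wreath_base_iff: "g \<in> wreath_base H \<longleftrightarrow> g \<in> carrier W \<and> snd g = 0"
  by (cases g) (auto simp: wreath_base_def wreath_int_def semidirect_product_def)

lemma wreath_infinite: "infinite (carrier W)"
proof -
  have "inj (\<lambda>k::int. (\<lambda>_::int. \<one>\<^bsub>H\<^esub>, k))" by (auto intro: injI)
  then have "infinite (range (\<lambda>k::int. (\<lambda>_::int. \<one>\<^bsub>H\<^esub>, k)))"
    using range_inj_infinite infinite_UNIV_int finite_imageD by blast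
  moreover have "range (\<lambda>k::int. (\<lambda>_::int. \<one>\<^bsub>H\<^esub>, k)) \<subseteq> carrier W" by (auto simp: wreath_carrier)
  ultimately show ?thesis using finite_subset by blast
qed

text \<open>The finitely many letters have bounded step and reach; after that only finitely many
  lamps and two pads have to be written as words.\<close>

lemma lamp_words_exists:
  assumes a: "a \<in> carrier H" "a \<noteq> \<one>\<^bsub>H\<^esub>"
  shows "\<exists>D C. lamp_words H S a D C"
proof -
  have bdd: "\<exists>n::nat. \<forall>x\<in>E. f x \<le> n" if "finite E" for E :: "'x set" and f
    using that finite_nat_set_iff_bounded_le[of "f ` E"] by auto
  let ?L = "S \<union> m_inv W ` S"
  have fin: "finite (snd ` ?L \<union> \<Union>(sites ` ?L))"
    using finite_letters letters_closed sites_finite by blast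
  obtain D where D: "\<forall>i\<in>snd ` ?L \<union> \<Union>(sites ` ?L). nat \<bar>i\<bar> \<le> D"
    using bdd[OF fin, of "\<lambda>i. nat \<bar>i\<bar>"] by blast
  have D1: "\<bar>snd s\<bar> \<le> int D" if "s \<in> ?L" for s
    using D that by (metis UnI1 image_eqI nat_le_iff)
  have D2: "sites s \<subseteq> {- int D..int D}" if "s \<in> ?L" for s
  proof
    fix i assume "i \<in> sites s"
    then have "nat \<bar>i\<bar> \<le> D" using D that by blast
    then show "i \<in> {- int D..int D}" by auto
  qed
  define site_lamp where "site_lamp d = (\<lambda>j. if - j = d then a else \<one>\<^bsub>H\<^esub>, 0::int)" for d :: int
  have "site_lamp d \<in> carrier W" for d
  proof -
    have "{j. fst (site_lamp d) j \<noteq> \<one>\<^bsub>H\<^esub>} \<subseteq> {- d}" by (auto simp: site_lamp_def)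
    then have "finite {j. fst (site_lamp d) j \<noteq> \<one>\<^bsub>H\<^esub>}" by (rule finite_subset) simp
    then show ?thesis using a by (auto simp: wreath_carrier site_lamp_def)
  qed
  then have "\<exists>w. w \<in> words \<and> wval w = site_lamp d" for d using word_exists by blast
  then obtain f where f: "\<And>d. f d \<in> words \<and> wval (f d) = site_lamp d" by metis
  obtain C1 where C1: "\<forall>d\<in>{- int D..int D}. length (f d) \<le> C1"
    using bdd[of "{- int D..int D}" "\<lambda>d. length (f d)"] by auto
  obtain C2 where C2: "\<forall>\<sigma>\<in>{1, -1}. len (\<lambda>_. \<one>\<^bsub>H\<^esub>, \<sigma> * (2 * int D + 1)) \<le> C2"
    using bdd[of "{1, -1}" "\<lambda>\<sigma>. len (\<lambda>_. \<one>\<^bsub>H\<^esub>, \<sigma> * (2 * int D + 1))"] by auto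
  have "lamp_words H S a D (max C1 C2)"
  proof unfold_locales
    fix d :: int assume "\<bar>d\<bar> \<le> int D"
    then have "d \<in> {- int D..int D}" by auto
    then have "length (f d) \<le> max C1 C2" using C1 max.coboundedI1 by blast
    then show "\<exists>w\<in>words. wval w = (\<lambda>j. if - j = d then a else \<one>\<^bsub>H\<^esub>, 0) \<and> length w \<le> max C1 C2"
      using f[of d] by (auto simp: site_lamp_def)
  next
    fix \<sigma> :: int assume "\<sigma> \<in> {1, -1}"
    then show "len (\<lambda>_. \<one>\<^bsub>H\<^esub>, \<sigma> * (2 * int D + 1)) \<le> max C1 C2"
      using C2 by (meson max.coboundedI2)
  qed (use a D1 D2 in auto)
  then show ?thesis by blast
qed

text \<open>Geodesics of base elements are closed words, so \<open>closed_words_bound\<close>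
  applies below the radius, and continuity carries the bound to the radius itself.\<close>

lemma base_series_bounded:
  "\<exists>M. \<forall>F. finite F \<longrightarrow> F \<subseteq> wreath_base H \<longrightarrow> (\<Sum>g\<in>F. (1 / growth_rate) ^ len g) \<le> M"
proof (cases "carrier H = {\<one>\<^bsub>H\<^esub>}")
  case True
  \<comment> \<open>A trivial \<open>H\<close> offers no lamp to move, but then the base group is
    trivial.\<close>
  have "g = \<one>\<^bsub>W\<^esub>" if "g \<in> wreath_base H" for g
    using that True fst_closed[of g] by (auto simp: wreath_base_iff wreath_one prod_eq_iff)
  then have "(\<Sum>g\<in>F. (1 / growth_rate) ^ len g) \<le> 1" if "F \<subseteq> wreath_base H" for F
  proof -
    have "F = {} \<or> F = {\<one>\<^bsub>W\<^esub>}" using that \<open>\<And>g. g \<in> wreath_base H \<Longrightarrow> g = \<one>\<^bsub>W\<^esub>\<close> by blast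
    then show ?thesis by auto
  qed
  then show ?thesis by blast
next
  case False
  then obtain a where "a \<in> carrier H" "a \<noteq> \<one>\<^bsub>H\<^esub>" by blast
  from lamp_words_exists[OF this] obtain D C where "lamp_words H S a D C" by blast
  then interpret lamp_words H S a D C .
  \<comment> \<open>Half the radius serves as a fixed positive lower end for the range of
    \<open>z\<close>.\<close>
  define z0 where "z0 = 1 / (2 * growth_rate)"
  have z0: "0 < z0" "z0 < 1 / growth_rate" using growth_rate_ge_1 by (auto simp: z0_def field_simps)
  \<comment> \<open>The constants are spelled out in terms of \<open>z0\<close> so that
    \<open>M\<close> is fixed before \<open>z\<close> is chosen.\<close>
  define \<kappa> where "\<kappa> = 1 + z0 ^ (2 * C)"
  define \<beta> where "\<beta> = \<kappa> ^ (2 * nat (2 * K + 1)) / z0 ^ C"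
  define M where "M = 2 * (\<beta> * exp (\<beta> / (1 - 1 / \<kappa>)) ^ 2 * (1 / (1 - 1 / \<kappa>) ^ 2) ^ 2)"
  have "(\<Sum>g\<in>F. (1 / growth_rate) ^ len g) \<le> M" if F: "finite F" "F \<subseteq> wreath_base H" for F
  proof (rule sum_at_radius_le[OF F(1) z0(2)])
    fix z assume z: "z0 \<le> z" "z < 1 / growth_rate"
    interpret wt: lamp_words_weight H S a D C z0 z
      by unfold_locales (use z0 z in auto)
    have "\<exists>w. w \<in> words \<and> wval w = g \<and> length w = len g" if "g \<in> F" for g
    proof -
      have "g \<in> carrier W" using that F(2) wreath_base_iff by blast
      then show ?thesis by (rule geodesic_exists) blast
    qed
    then obtain f where f: "\<And>g. g \<in> F \<Longrightarrow> f g \<in> words \<and> wval (f g) = g \<and> length (f g) = len g" by metis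
    have inj: "inj_on f F" using f by (metis inj_onI)
    have "(\<Sum>g\<in>F. z ^ len g) = (\<Sum>w\<in>f ` F. z ^ length w)"
      using f by (simp add: sum.reindex[OF inj])
    also have "\<dots> \<le> M"
      unfolding M_def \<beta>_def \<kappa>_def
    proof (rule wboundD[OF wt.closed_words_bound[unfolded wt.\<beta>_def wt.\<kappa>_def]])
      show "f ` F \<subseteq> {w \<in> words. shift w = 0}"
      proof
        fix w assume "w \<in> f ` F"
        then obtain g where g: "g \<in> F" "w = f g" by blast
        then have "g \<in> wreath_base H" using F(2) by blast
        then have "snd (wval w) = 0" using f[OF g(1)] by (simp add: wreath_base_iff g(2))
        then have "shift w = 0" by simp
        then show "w \<in> {w \<in> words. shift w = 0}" using f[OF g(1)] by (simp add: g(2))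
      qed
      show "inj_on wval (f ` F)" using f by (auto simp: inj_on_def)
    qed (use F in auto)
    finally show "(\<Sum>g\<in>F. z ^ len g) \<le> M" .
  qed
  then show ?thesis by blast
qed

end

theorem theorem2:
  fixes H :: "('a, 'b) monoid_scheme"
    and S :: "((int \<Rightarrow> 'a) \<times> int) set"
  assumes "finitely_generated_group H"
    and "finite S"
    and "S \<subseteq> carrier (wreath_int H)"
    and "generate (wreath_int H) S = carrier (wreath_int H)"
  shows "growth_density (wreath_int H) S (wreath_base H) = 0"
proof -
  have H: "group H" using assms(1) by (simp add: finitely_generated_group_def)
  interpret wreath_generated H S
    by (intro wreath_generated.intro generated_group.intro generated_group_axioms.intro H
        group_wreath_int assms)
  obtain M where "\<And>F. finite F \<Longrightarrow> F \<subseteq> wreath_base H \<Longrightarrow> (\<Sum>g\<in>F. (1 / growth_rate) ^ len g) \<le> M"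
    using base_series_bounded by blast
  then show ?thesis
    by (rule growth_density_zero[rotated 2]) (auto simp: wreath_base_iff wreath_infinite)
qed

end
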